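(* Let $A, B \in \mathbb{P}$ and $t \in [0,1]$. Then the following statements hold. (1) If $F_{t}(A^{-1}, B) \leq A^{2(t-1)}$, then $A^{p} \sharp_{t} B^{p} \leq I$ for all $p \geq 1$. (2) For $t \in (0,1]$: $F_{t}(A, B) = A^{2-2t}$ if and only if $B = A^{\frac{1}{t}-1}$.
   Context: $\mathbb{P}$ denotes the set of positive definite (i.e. positive invertible) bounded linear operators on a complex Hilbert space $\mathcal{H}$; $I$ is the identity operator and $\leq$ is the L\"owner order on bounded self-adjoint operators ($X \le Y$ iff $Y-X$ is positive semidefinite). Real powers of elements of $\mathbb{P}$ are defined by functional calculus. For $A,B\in\mathbb{P}$ and $t\in[0,1]$, the weighted (metric) geometric mean is $A \sharp_{t} B := A^{1/2} (A^{-1/2} B A^{-1/2})^{t} A^{1/2}$, and the new weighted spectral geometric mean is $F_{t}(A, B) := (A^{-1} \sharp_{t} B)^{1/2} A^{2-2t} (A^{-1} \sharp_{t} B)^{1/2}$. *)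

theory Defs
  imports "HOL-Analysis.Analysis" "HOL-Computational_Algebra.Polynomial"
begin

text \<open>
  Complex Hilbert spaces of arbitrary dimension (the zero space included), with the inner product
  linear in its first argument.  The scalar action over the reals, the norm and the topology are
  those of the library class \<open>real_normed_vector\<close>, tied to the complex structure by
  \<open>scaleR_scaleC\<close> and \<open>norm_eq_sqrt_cinner\<close>.
\<close>

class complex_inner = real_normed_vector +
  fixes scaleC :: "complex \<Rightarrow> 'a \<Rightarrow> 'a"  (infixr "*\<^sub>C" 75)
    and cinner :: "'a \<Rightarrow> 'a \<Rightarrow> complex"
  assumes scaleC_add_right: "c *\<^sub>C (x + y) = c *\<^sub>C x + c *\<^sub>C y"
    and scaleC_add_left: "(c + d) *\<^sub>C x = c *\<^sub>C x + d *\<^sub>C x"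
    and scaleC_scaleC: "c *\<^sub>C (d *\<^sub>C x) = (c * d) *\<^sub>C x"
    and scaleR_scaleC: "r *\<^sub>R x = complex_of_real r *\<^sub>C x"
    and cinner_commute: "cinner x y = cnj (cinner y x)"
    and cinner_add_left: "cinner (x + y) z = cinner x z + cinner y z"
    and cinner_scaleC_left: "cinner (c *\<^sub>C x) y = c * cinner x y"
    and Re_cinner_self_nonneg: "0 \<le> Re (cinner x x)"
    and norm_eq_sqrt_cinner: "norm x = sqrt (Re (cinner x x))"

class complex_hilbert_space = complex_inner + complete_space

instantiation complex :: complex_hilbert_space
begin

definition scaleC_complex :: "complex \<Rightarrow> complex \<Rightarrow> complex"
  where "scaleC_complex c x = c * x"

definition cinner_complex :: "complex \<Rightarrow> complex \<Rightarrow> complex"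
  where "cinner_complex x y = x * cnj y"

instance
  by standard
    (auto simp: scaleC_complex_def cinner_complex_def algebra_simps scaleR_conv_of_real
      cmod_def power2_eq_square)

end

lemma norm_scaleC: "norm (c *\<^sub>C x) = cmod c * norm (x :: 'a::complex_inner)"
proof -
  have "cinner (c *\<^sub>C x) (c *\<^sub>C x) = c * cnj (cinner (c *\<^sub>C x) x)"
    by (metis cinner_scaleC_left cinner_commute)
  also have "\<dots> = (c * cnj c) * cnj (cinner x x)"
    by (simp add: cinner_scaleC_left)
  also have "\<dots> = complex_of_real ((cmod c)\<^sup>2) * cinner x x"
    by (metis complex_norm_square cinner_commute)
  finally have "Re (cinner (c *\<^sub>C x) (c *\<^sub>C x)) = (cmod c)\<^sup>2 * Re (cinner x x)"
    by simp
  then show ?thesis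
    by (simp add: norm_eq_sqrt_cinner [where 'a = 'a] real_sqrt_mult)
qed

text \<open>
  A bounded operator on \<open>\<H>\<close> is a real-linear \<open>blinfun\<close> satisfying \<open>clinear_op\<close>; this keeps the
  library's operator norm and composition.
\<close>

definition clinear_op :: "('a::complex_inner \<Rightarrow>\<^sub>L 'a) \<Rightarrow> bool"
  where "clinear_op T \<longleftrightarrow> (\<forall>c x. blinfun_apply T (c *\<^sub>C x) = c *\<^sub>C blinfun_apply T x)"

lift_definition scalar_op :: "complex \<Rightarrow> 'a::complex_inner \<Rightarrow>\<^sub>L 'a" is "\<lambda>c x. c *\<^sub>C x"
proof -
  fix c :: complex
  show "bounded_linear (\<lambda>x :: 'a. c *\<^sub>C x)"
    by (rule bounded_linear_intro [where K = "cmod c"])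
      (simp_all add: scaleC_add_right scaleR_scaleC scaleC_scaleC norm_scaleC mult.commute)
qed

definition is_op_inverse :: "('a::complex_inner \<Rightarrow>\<^sub>L 'a) \<Rightarrow> ('a \<Rightarrow>\<^sub>L 'a) \<Rightarrow> bool"
  where "is_op_inverse T S \<longleftrightarrow>
    clinear_op S \<and> T o\<^sub>L S = id_blinfun \<and> S o\<^sub>L T = id_blinfun"

definition invertible_op :: "('a::complex_inner \<Rightarrow>\<^sub>L 'a) \<Rightarrow> bool"
  where "invertible_op T \<longleftrightarrow> (\<exists>S. is_op_inverse T S)"

definition op_inverse :: "('a::complex_inner \<Rightarrow>\<^sub>L 'a) \<Rightarrow> ('a \<Rightarrow>\<^sub>L 'a)"
  where "op_inverse T = (THE S. is_op_inverse T S)"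

definition self_adjoint :: "('a::complex_inner \<Rightarrow>\<^sub>L 'a) \<Rightarrow> bool"
  where "self_adjoint T \<longleftrightarrow> clinear_op T \<and>
    (\<forall>x y. cinner (blinfun_apply T x) y = cinner x (blinfun_apply T y))"

definition positive_semidefinite :: "('a::complex_inner \<Rightarrow>\<^sub>L 'a) \<Rightarrow> bool"
  where "positive_semidefinite T \<longleftrightarrow>
    self_adjoint T \<and> (\<forall>x. 0 \<le> Re (cinner (blinfun_apply T x) x))"

definition positive_definite :: "('a::complex_inner \<Rightarrow>\<^sub>L 'a) \<Rightarrow> bool"
  where "positive_definite T \<longleftrightarrow> positive_semidefinite T \<and> invertible_op T"

definition loewner_le :: "('a::complex_inner \<Rightarrow>\<^sub>L 'a) \<Rightarrow> ('a \<Rightarrow>\<^sub>L 'a) \<Rightarrow> bool"  (infix "\<preceq>" 50)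
  where "X \<preceq> Y \<longleftrightarrow> self_adjoint X \<and> self_adjoint Y \<and> positive_semidefinite (Y - X)"

definition op_spectrum :: "('a::complex_inner \<Rightarrow>\<^sub>L 'a) \<Rightarrow> complex set"
  where "op_spectrum T = {c. \<not> invertible_op (T - scalar_op c)}"

definition poly_op :: "real poly \<Rightarrow> ('a::complex_inner \<Rightarrow>\<^sub>L 'a) \<Rightarrow> ('a \<Rightarrow>\<^sub>L 'a)"
  where "poly_op p T = (\<Sum>i\<le>degree p. coeff p i *\<^sub>R (((o\<^sub>L) T ^^ i) id_blinfun))"

text \<open>
  Continuous functional calculus of a self-adjoint operator \<open>T\<close>: \<open>f(T)\<close> is the common operator-norm
  limit of \<open>p\<^sub>n(T)\<close> over all real polynomial sequences \<open>p\<^sub>n\<close> converging to \<open>f\<close> uniformly on the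
  spectrum, which is compact and real.  It is determined when \<open>f\<close> is continuous on the spectrum
  (such a sequence then exists by Weierstrass) and meaningless otherwise.
\<close>

definition func_calc :: "(real \<Rightarrow> real) \<Rightarrow> ('a::complex_inner \<Rightarrow>\<^sub>L 'a) \<Rightarrow> ('a \<Rightarrow>\<^sub>L 'a)"
  where "func_calc f T = (THE X. \<forall>p :: nat \<Rightarrow> real poly.
    uniform_limit {x. complex_of_real x \<in> op_spectrum T} (\<lambda>n. poly (p n)) f sequentially
      \<longrightarrow> (\<lambda>n. poly_op (p n) T) \<longlonglongrightarrow> X)"

definition op_powr :: "('a::complex_inner \<Rightarrow>\<^sub>L 'a) \<Rightarrow> real \<Rightarrow> ('a \<Rightarrow>\<^sub>L 'a)"  (infixr "powr\<^sub>o" 80)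
  where "T powr\<^sub>o r = func_calc (\<lambda>x. x powr r) T"

definition geometric_mean ::
    "real \<Rightarrow> ('a::complex_inner \<Rightarrow>\<^sub>L 'a) \<Rightarrow> ('a \<Rightarrow>\<^sub>L 'a) \<Rightarrow> ('a \<Rightarrow>\<^sub>L 'a)"
  where "geometric_mean t A B =
    A powr\<^sub>o (1/2) o\<^sub>L (A powr\<^sub>o (-1/2) o\<^sub>L B o\<^sub>L A powr\<^sub>o (-1/2)) powr\<^sub>o t o\<^sub>L A powr\<^sub>o (1/2)"

definition spectral_mean ::
    "real \<Rightarrow> ('a::complex_inner \<Rightarrow>\<^sub>L 'a) \<Rightarrow> ('a \<Rightarrow>\<^sub>L 'a) \<Rightarrow> ('a \<Rightarrow>\<^sub>L 'a)"
  where "spectral_mean t A B =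
    (geometric_mean t (op_inverse A) B) powr\<^sub>o (1/2) o\<^sub>L A powr\<^sub>o (2 - 2 * t)
      o\<^sub>L (geometric_mean t (op_inverse A) B) powr\<^sub>o (1/2)"

end

theory Submission
  imports Defs "HOL-Computational_Algebra.Fundamental_Theorem_Algebra"
begin

text \<open>
  The inequalities rest on one principle: a self-adjoint operator that is similar to a contraction is at
  most the identity (\<open>self_adjoint_similar_to_contraction_le_id\<close>), because similarity preserves the
  spectrum and the spectrum of a self-adjoint operator controls its quadratic form.

  For the first part, let \<open>G\<close> be the geometric mean of \<open>A\<close> and \<open>B\<close> with weight \<open>t\<close>, let \<open>g\<close> be its square root,
  and let \<open>C = A powr\<^sub>o (2 * (t - 1))\<close>.  The hypothesis reads \<open>g o\<^sub>L C o\<^sub>L g \<preceq> C\<close>; it says that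
  \<open>C powr\<^sub>o (1/2) o\<^sub>L g o\<^sub>L C powr\<^sub>o (-1/2)\<close> is a contraction, so \<open>g \<preceq> id_blinfun\<close> and \<open>G \<preceq> id_blinfun\<close>.  The
  Ando-Hiai inequality (\<open>ando_hiai\<close>) carries this bound over to the mean of the powers with exponent \<open>p\<close>.
  That inequality follows, for exponents between \<open>1\<close> and \<open>2\<close>, from joint monotonicity and conjugation
  invariance of geometric means, and then for all exponents by doubling; monotonicity of the means
  is the Loewner-Heinz inequality (\<open>loewner_heinz\<close>), which again comes from the principle above.

  For the second part, let \<open>g\<close> be the square root of the mean of the inverse of \<open>A\<close> with \<open>B\<close>, and let
  \<open>D = A powr\<^sub>o (2 - 2 * t)\<close>.  The equation reads \<open>g o\<^sub>L D o\<^sub>L g = D\<close>, which by uniqueness of positive square roots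
  means that \<open>g\<close> is the identity (\<open>eq_id_of_conj_eq\<close>); solving the resulting equation for \<open>B\<close> gives the
  claimed power of \<open>A\<close>.

  Everything depends on a continuous functional calculus for positive definite operators and
  functions that are continuous on \<open>{0<..}\<close>.  It is built from the bound on polynomials of \<open>T\<close> by their
  values on the spectrum (\<open>poly_op_norm_le\<close>), which follows from the fundamental theorem of algebra and
  from the invertibility of coercive operators (\<open>coercive_invertible\<close>).  Its basic rule for handling
  noncommuting operators is \<open>func_calc_intertwine\<close>.
\<close>

section \<open>Inner product and adjoint pairs\<close>

subclass (in complex_hilbert_space) banach ..

lemma norm_squared_eq_cinner: "(norm x)\<^sup>2 = Re (cinner x x)"
  for x :: "'a::complex_inner"
  by (simp add: norm_eq_sqrt_cinner [where 'a = 'a] Re_cinner_self_nonneg)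

lemma Re_cinner_commute: "Re (cinner x y) = Re (cinner y x)"
  by (metis cinner_commute complex_cnj cnj.simps(1))

lemma cinner_add_right: "cinner x (y + z) = cinner x y + cinner x z"
  by (metis cinner_commute cinner_add_left complex_cnj_add)

lemma cinner_scaleC_right: "cinner x (c *\<^sub>C y) = cnj c * cinner x y"
  by (metis cinner_commute cinner_scaleC_left complex_cnj_mult)

lemma cinner_scaleR_left: "cinner (r *\<^sub>R (x :: 'a::complex_inner)) y = r *\<^sub>R cinner x y"
  by (simp only: scaleR_scaleC [where 'a = 'a] cinner_scaleC_left scaleR_conv_of_real)

lemma cinner_scaleR_right: "cinner (x :: 'a::complex_inner) (r *\<^sub>R y) = r *\<^sub>R cinner x y"
  by (simp only: scaleR_scaleC [where 'a = 'a] cinner_scaleC_right scaleR_conv_of_real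
      complex_cnj_complex_of_real)

lemma quadratic_nonneg_discriminant:
  fixes a b c :: real
  assumes "\<And>r. 0 \<le> a + 2 * r * b + r\<^sup>2 * c" and "0 \<le> c"
  shows "b\<^sup>2 \<le> a * c"
proof (cases "c = 0")
  case True
  have "b = 0"
  proof (rule ccontr)
    assume "b \<noteq> 0"
    with assms(1) [of "- (a + 1) / (2 * b)"] True show False
      by (simp add: field_simps)
  qed
  with True show ?thesis by simp
next
  case False
  with assms(2) have "c > 0" by simp
  with assms(1) [of "- b / c"] show ?thesis
    by (simp add: field_simps power2_eq_square)
qed

definition adjoint_pair :: "('a::complex_inner \<Rightarrow>\<^sub>L 'a) \<Rightarrow> ('a \<Rightarrow>\<^sub>L 'a) \<Rightarrow> bool"
  where "adjoint_pair S T \<longleftrightarrow> (\<forall>x y. cinner (S x) y = cinner x (T y))"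

lemma adjoint_pairD: "adjoint_pair S T \<Longrightarrow> cinner (S x) y = cinner x (T y)"
  by (simp add: adjoint_pair_def)

lemma adjoint_pair_sym: "adjoint_pair S T \<Longrightarrow> adjoint_pair T S"
  unfolding adjoint_pair_def by (metis cinner_commute)

lemma adjoint_pair_compose:
  "adjoint_pair S T \<Longrightarrow> adjoint_pair S' T' \<Longrightarrow> adjoint_pair (S o\<^sub>L S') (T' o\<^sub>L T)"
  by (simp add: adjoint_pair_def)

lemma cinner_eq_all_imp_eq:
  fixes x y :: "'a::complex_inner"
  assumes "\<And>z. cinner x z = cinner y z"
  shows "x = y"
proof -
  have "cinner (x - y) (x - y) = 0"
    using assms [of "x - y"] cinner_add_left [of "x - y" y "x - y"] by simp
  then have "(norm (x - y))\<^sup>2 = 0"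
    by (simp only: norm_squared_eq_cinner zero_complex.sel)
  then show ?thesis by simp
qed

text \<open>
  Both \<open>S (c *\<^sub>C x)\<close> and \<open>c *\<^sub>C S x\<close> have the inner product \<open>c * cinner x (T z)\<close> with every vector \<open>z\<close>.
\<close>

lemma adjoint_pair_clinear:
  assumes "adjoint_pair S T"
  shows "clinear_op S"
proof -
  have "S (c *\<^sub>C x) = c *\<^sub>C S x" for c x
    by (rule cinner_eq_all_imp_eq) (simp add: adjoint_pairD [OF assms] cinner_scaleC_left)
  then show ?thesis by (simp add: clinear_op_def)
qed

lemma self_adjoint_iff_adjoint_pair: "self_adjoint T \<longleftrightarrow> adjoint_pair T T"
  using adjoint_pair_clinear [of T T] by (auto simp: self_adjoint_def adjoint_pair_def)

text \<open>
  The form of \<open>K\<close> at \<open>x + r *\<^sub>R y\<close> is a nonnegative real quadratic polynomial in \<open>r\<close>.  The case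
  \<open>K = id_blinfun\<close> gives the usual inequality; the general case converts invertibility of \<open>K\<close> into
  coercivity.
\<close>

lemma psd_cauchy_schwarz:
  assumes "positive_semidefinite K"
  shows "(Re (cinner (K x) y))\<^sup>2 \<le> Re (cinner (K x) x) * Re (cinner (K y) y)"
proof (rule quadratic_nonneg_discriminant)
  have sa: "cinner (K u) v = cinner u (K v)" and nn: "0 \<le> Re (cinner (K u) u)" for u v
    using assms by (auto simp: positive_semidefinite_def self_adjoint_def)
  show "0 \<le> Re (cinner (K y) y)" by (rule nn)
  fix r
  have "Re (cinner (K y) x) = Re (cinner (K x) y)"
    by (metis sa Re_cinner_commute)
  then have "Re (cinner (K (x + r *\<^sub>R y)) (x + r *\<^sub>R y))
      = Re (cinner (K x) x) + 2 * r * Re (cinner (K x) y) + r\<^sup>2 * Re (cinner (K y) y)"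
    by (simp add: blinfun.bilinear_simps cinner_add_left cinner_add_right cinner_scaleR_left
        cinner_scaleR_right power2_eq_square algebra_simps)
  with nn [of "x + r *\<^sub>R y"]
  show "0 \<le> Re (cinner (K x) x) + 2 * r * Re (cinner (K x) y) + r\<^sup>2 * Re (cinner (K y) y)"
    by simp
qed

lemma self_adjoint_id: "self_adjoint id_blinfun"
  by (simp add: self_adjoint_iff_adjoint_pair adjoint_pair_def)

lemma psd_id: "positive_semidefinite id_blinfun"
  by (simp add: positive_semidefinite_def self_adjoint_id Re_cinner_self_nonneg)

lemma Re_cinner_le_norm: "\<bar>Re (cinner x y)\<bar> \<le> norm x * norm (y :: 'a::complex_inner)"
proof -
  have "(Re (cinner x y))\<^sup>2 \<le> (norm x * norm y)\<^sup>2"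
    using psd_cauchy_schwarz [OF psd_id, of x y]
    by (simp add: power_mult_distrib norm_squared_eq_cinner)
  then show ?thesis
    by (metis abs_le_square_iff abs_of_nonneg mult_nonneg_nonneg norm_ge_zero)
qed

lemma cmod_cinner_le_norm: "cmod (cinner x y) \<le> norm x * norm (y :: 'a::complex_inner)"
proof (cases "cinner x y = 0")
  case False
  \<comment> \<open>The unimodular factor that rotates the inner product onto the positive real axis.\<close>
  define c where "c = cnj (sgn (cinner x y))"
  have "cmod c = 1" using False by (simp add: c_def norm_sgn)
  have "cinner (c *\<^sub>C x) y = of_real (cmod (cinner x y))"
    using False
    by (simp add: c_def cinner_scaleC_left sgn_eq field_simps complex_norm_square [symmetric]
        power2_eq_square)
  then have "cmod (cinner x y) \<le> norm (c *\<^sub>C x) * norm y"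
    using Re_cinner_le_norm [of "c *\<^sub>C x" y] by simp
  then show ?thesis by (simp add: norm_scaleC \<open>cmod c = 1\<close>)
qed simp

interpretation cinner: bounded_bilinear "cinner :: 'a::complex_inner \<Rightarrow> 'a \<Rightarrow> complex"
  by unfold_locales
    (auto intro!: exI [of _ 1] cmod_cinner_le_norm
      simp: cinner_add_left cinner_add_right cinner_scaleR_left cinner_scaleR_right)

lemmas cinner_simps = cinner.add_left cinner.add_right cinner.diff_left cinner.diff_right
  cinner.scaleR_left cinner.scaleR_right cinner.zero_left cinner.zero_right
  cinner.minus_left cinner.minus_right blinfun.bilinear_simps

lemma norm_diff_squared:
  "(norm (x - y))\<^sup>2 = (norm x)\<^sup>2 - 2 * Re (cinner y x) + (norm (y :: 'a::complex_inner))\<^sup>2"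
  using Re_cinner_commute [of x y] by (simp add: norm_squared_eq_cinner cinner_simps)

lemma self_adjointD: "self_adjoint T \<Longrightarrow> cinner (T x) y = cinner x (T y)"
  by (simp add: self_adjoint_def)

lemma self_adjoint_clinear: "self_adjoint T \<Longrightarrow> clinear_op T"
  by (simp add: self_adjoint_def)

lemma self_adjoint_add: "self_adjoint S \<Longrightarrow> self_adjoint T \<Longrightarrow> self_adjoint (S + T)"
  and self_adjoint_diff: "self_adjoint S \<Longrightarrow> self_adjoint T \<Longrightarrow> self_adjoint (S - T)"
  and self_adjoint_scaleR: "self_adjoint S \<Longrightarrow> self_adjoint (r *\<^sub>R S)"
  and self_adjoint_zero: "self_adjoint 0"
  by (simp_all add: self_adjoint_iff_adjoint_pair adjoint_pair_def cinner_simps)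

lemma self_adjoint_limit:
  assumes "\<And>n. self_adjoint (X n)" and "X \<longlonglongrightarrow> T"
  shows "self_adjoint T"
proof -
  have "cinner (T x) y = cinner x (T y)" for x y
  proof (rule LIMSEQ_unique)
    show "(\<lambda>n. cinner (X n x) y) \<longlonglongrightarrow> cinner (T x) y"
      by (intro cinner.tendsto blinfun.tendsto tendsto_const assms)
    show "(\<lambda>n. cinner (X n x) y) \<longlonglongrightarrow> cinner x (T y)"
      unfolding self_adjointD [OF assms(1)]
      by (intro cinner.tendsto blinfun.tendsto tendsto_const assms)
  qed
  then show ?thesis by (simp add: self_adjoint_iff_adjoint_pair adjoint_pair_def)
qed

lemma clinear_op_scalar: "clinear_op (scalar_op c)"
  by (simp add: clinear_op_def scalar_op.rep_eq scaleC_scaleC mult.commute)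

lemma scaleC_zero_right: "c *\<^sub>C (0 :: 'a::complex_inner) = 0"
  by (metis norm_eq_zero norm_scaleC mult_zero_right)

lemma scaleC_minus_right: "c *\<^sub>C (- x) = - (c *\<^sub>C (x :: 'a::complex_inner))"
  by (metis add_eq_0_iff scaleC_add_right scaleC_zero_right add.right_inverse)

lemma scaleC_diff_right: "c *\<^sub>C (x - y) = c *\<^sub>C x - c *\<^sub>C (y :: 'a::complex_inner)"
  using scaleC_add_right [of c x "- y"] by (simp add: scaleC_minus_right)

lemma clinear_op_compose: "clinear_op S \<Longrightarrow> clinear_op T \<Longrightarrow> clinear_op (S o\<^sub>L T)"
  and clinear_op_diff: "clinear_op S \<Longrightarrow> clinear_op T \<Longrightarrow> clinear_op (S - T)"
  and clinear_op_add: "clinear_op S \<Longrightarrow> clinear_op T \<Longrightarrow> clinear_op (S + T)"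
  by (simp_all add: clinear_op_def blinfun.bilinear_simps scaleC_diff_right scaleC_add_right)

section \<open>Coercive operators and invertibility\<close>

lemma blinfun_compose_assoc: "(S o\<^sub>L T) o\<^sub>L X = S o\<^sub>L (T o\<^sub>L X)"
  by (rule blinfun_eqI) simp

lemma blinfun_compose_id [simp]: "id_blinfun o\<^sub>L T = T" "T o\<^sub>L id_blinfun = T"
  by (auto intro: blinfun_eqI)

lemmas compose_bilinear_simps =
  bounded_bilinear.add_left [OF bounded_bilinear_blinfun_compose]
  bounded_bilinear.add_right [OF bounded_bilinear_blinfun_compose]
  bounded_bilinear.diff_left [OF bounded_bilinear_blinfun_compose]
  bounded_bilinear.diff_right [OF bounded_bilinear_blinfun_compose]
  bounded_bilinear.scaleR_left [OF bounded_bilinear_blinfun_compose]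
  bounded_bilinear.scaleR_right [OF bounded_bilinear_blinfun_compose]
  bounded_bilinear.minus_left [OF bounded_bilinear_blinfun_compose]
  bounded_bilinear.minus_right [OF bounded_bilinear_blinfun_compose]

lemma is_op_inverse_unique: "is_op_inverse T S \<Longrightarrow> is_op_inverse T S' \<Longrightarrow> S = S'"
proof -
  assume "is_op_inverse T S" "is_op_inverse T S'"
  then have "S o\<^sub>L T = id_blinfun" "T o\<^sub>L S' = id_blinfun"
    by (auto simp: is_op_inverse_def)
  with blinfun_compose_assoc [of S T S'] show "S = S'" by simp
qed

lemma op_inverse_eqI: "is_op_inverse T S \<Longrightarrow> op_inverse T = S"
  unfolding op_inverse_def by (blast intro: the_equality is_op_inverse_unique)

lemma is_op_inverse_compose:
  "is_op_inverse S S' \<Longrightarrow> is_op_inverse T T' \<Longrightarrow> is_op_inverse (S o\<^sub>L T) (T' o\<^sub>L S')"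
proof -
  assume S: "is_op_inverse S S'" and T: "is_op_inverse T T'"
  have "T o\<^sub>L (T' o\<^sub>L S') = S'" "S' o\<^sub>L (S o\<^sub>L T) = T"
    using S T by (simp_all add: is_op_inverse_def flip: blinfun_compose_assoc)
  with S T show ?thesis
    by (simp add: is_op_inverse_def clinear_op_compose blinfun_compose_assoc)
qed

lemma invertible_op_compose:
  "invertible_op S \<Longrightarrow> invertible_op T \<Longrightarrow> invertible_op (S o\<^sub>L T)"
  unfolding invertible_op_def by (blast intro: is_op_inverse_compose)

lemma invertible_op_commuting_factor:
  assumes "invertible_op (S o\<^sub>L T)" and "S o\<^sub>L T = T o\<^sub>L S" and "clinear_op T"
  shows "invertible_op S"
proof -
  obtain V where V: "clinear_op V" "S o\<^sub>L T o\<^sub>L V = id_blinfun" "V o\<^sub>L (S o\<^sub>L T) = id_blinfun"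
    using assms(1) by (auto simp: invertible_op_def is_op_inverse_def)
  have VTS: "(V o\<^sub>L T) o\<^sub>L S = id_blinfun"
    using V(3) by (simp only: blinfun_compose_assoc assms(2))
  have STV: "S o\<^sub>L (T o\<^sub>L V) = id_blinfun"
    using V(2) by (simp only: blinfun_compose_assoc)
  have "V o\<^sub>L T = T o\<^sub>L V"
    using blinfun_compose_assoc [of "V o\<^sub>L T" S "T o\<^sub>L V"] by (simp only: VTS STV blinfun_compose_id)
  then have "is_op_inverse S (T o\<^sub>L V)"
    using VTS STV V(1) assms(3) by (simp add: is_op_inverse_def clinear_op_compose)
  then show ?thesis unfolding invertible_op_def by blast
qed

lemma coercive_norm_le:
  assumes "c * (norm x)\<^sup>2 \<le> Re (cinner (R x) x)"
  shows "c * norm x \<le> norm (R x)"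
proof (cases "x = 0")
  case False
  have "(c * norm x) * norm x \<le> norm (R x) * norm x"
    using assms Re_cinner_le_norm [of "R x" x] by (simp add: power2_eq_square)
  with False show ?thesis by simp
qed (use assms in simp)

text \<open>
  The Lax-Milgram argument: \<open>y\<close> solves \<open>R y = x\<close> iff it is a fixed point of the relaxation
  \<open>y + k *\<^sub>R (x - R y)\<close>, which coercivity makes a contraction for a small step \<open>k\<close>.
\<close>

lemma coercive_surj:
  fixes R :: "'a::complex_hilbert_space \<Rightarrow>\<^sub>L 'a"
  assumes "c > 0" and coercive: "\<And>x. c * (norm x)\<^sup>2 \<le> Re (cinner (R x) x)"
  shows "\<exists>y. R y = x"
proof -
  \<comment> \<open>The summand \<open>c\<close> keeps \<open>N\<close> positive and at least \<open>c\<close>; the step \<open>k\<close> minimises the bound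
    \<open>1 - 2 * k * c + k\<^sup>2 * N\<^sup>2\<close> on the square of the contraction factor, and \<open>q\<close> is the minimum.\<close>
  define N where "N = norm R + c"
  define k where "k = c / N\<^sup>2"
  define q where "q = 1 - c\<^sup>2 / N\<^sup>2"
  define f where "f = (\<lambda>y. y + k *\<^sub>R (x - R y))"
  have "N > 0" "c \<le> N" using assms(1) by (auto simp: N_def add_nonneg_pos)
  have "k > 0" using \<open>N > 0\<close> assms(1) by (simp add: k_def)
  have q: "0 \<le> q" "q < 1"
    using \<open>N > 0\<close> \<open>c \<le> N\<close> assms(1) by (auto simp: q_def power_mono)
  have "norm (w - k *\<^sub>R R w) \<le> sqrt q * norm w" for w
  proof -
    have "norm (R w) \<le> N * norm w"
      using norm_blinfun [of R w] assms(1) by (simp add: N_def distrib_right add_increasing2)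
    then have Rw: "(norm (R w))\<^sup>2 \<le> N\<^sup>2 * (norm w)\<^sup>2"
      by (metis power_mono norm_ge_zero power_mult_distrib)
    have "(norm (w - k *\<^sub>R R w))\<^sup>2
        = (norm w)\<^sup>2 - 2 * k * Re (cinner (R w) w) + k\<^sup>2 * (norm (R w))\<^sup>2"
      by (simp add: norm_diff_squared cinner.scaleR_left power_mult_distrib)
    also have "\<dots> \<le> (norm w)\<^sup>2 - 2 * k * (c * (norm w)\<^sup>2) + k\<^sup>2 * (N\<^sup>2 * (norm w)\<^sup>2)"
      using \<open>k > 0\<close> Rw coercive [of w] by (intro add_mono diff_mono mult_left_mono) auto
    also have "\<dots> = q * (norm w)\<^sup>2"
      using \<open>N > 0\<close> by (simp add: k_def q_def field_simps power2_eq_square)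
    finally have "(norm (w - k *\<^sub>R R w))\<^sup>2 \<le> (sqrt q * norm w)\<^sup>2"
      using q by (simp add: power_mult_distrib)
    then show ?thesis
      by (rule power2_le_imp_le) (use q in simp)
  qed
  moreover have "f y - f z = (y - z) - k *\<^sub>R R (y - z)" for y z
    by (simp add: f_def blinfun.bilinear_simps algebra_simps)
  ultimately have "\<forall>y z. dist (f y) (f z) \<le> sqrt q * dist y z"
    by (simp add: dist_norm)
  then have "\<exists>!y. f y = y"
    using q by (intro banach_fix_type [of "sqrt q"]) auto
  then obtain y where "f y = y" by blast
  with \<open>k > 0\<close> show ?thesis by (auto simp: f_def)
qed

lemma coercive_invertible:
  fixes R :: "'a::complex_hilbert_space \<Rightarrow>\<^sub>L 'a"
  assumes "clinear_op R" and "c > 0"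
    and coercive: "\<And>x. c * (norm x)\<^sup>2 \<le> Re (cinner (R x) x)"
  shows "invertible_op R"
proof -
  define S where "S = inv (blinfun_apply R)"
  have RS: "R (S x) = x" for x
  proof -
    obtain y where "R y = x" using coercive_surj [OF assms(2) coercive] by blast
    then have "x \<in> range (blinfun_apply R)" by blast
    then show ?thesis unfolding S_def by (rule f_inv_into_f)
  qed
  have below: "c * norm x \<le> norm (R x)" for x
    by (rule coercive_norm_le) (rule coercive)
  have inj: "x = y" if "R x = R y" for x y
    using below [of "x - y"] that assms(2) by (simp add: blinfun.bilinear_simps mult_le_0_iff)
  have SR: "S (R x) = x" for x
    by (rule inj) (rule RS)
  have "bounded_linear S"
  proof (rule bounded_linear_intro [where K = "1 / c"])
    show "S (x + y) = S x + S y" for x y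
      by (rule inj) (simp add: RS blinfun.bilinear_simps)
    show "S (r *\<^sub>R x) = r *\<^sub>R S x" for r x
      by (rule inj) (simp add: RS blinfun.bilinear_simps)
    show "norm (S x) \<le> norm x * (1 / c)" for x
      using below [of "S x"] assms(2) by (simp add: RS field_simps)
  qed
  then have [simp]: "blinfun_apply (Blinfun S) = S"
    by (rule bounded_linear_Blinfun_apply)
  have "S (z *\<^sub>C x) = z *\<^sub>C S x" for z x
    by (rule inj) (use assms(1) in \<open>simp add: RS clinear_op_def\<close>)
  then have "clinear_op (Blinfun S)" by (simp add: clinear_op_def)
  moreover have "R o\<^sub>L Blinfun S = id_blinfun" "Blinfun S o\<^sub>L R = id_blinfun"
    by (rule blinfun_eqI, simp add: RS SR)+
  ultimately have "is_op_inverse R (Blinfun S)" by (simp add: is_op_inverse_def)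
  then show ?thesis by (auto simp: invertible_op_def)
qed

text \<open>
  With \<open>V\<close> the inverse of \<open>K\<close>, Cauchy-Schwarz for the form of \<open>K\<close> at \<open>V x\<close> and \<open>x\<close> bounds the fourth
  power of \<open>norm x\<close> by \<open>Re (cinner x (V x))\<close> times the form of \<open>K\<close> at \<open>x\<close>.
\<close>

lemma psd_invertible_coercive:
  assumes "positive_semidefinite K" and "invertible_op K"
  obtains c where "c > 0" and "\<And>x. c * (norm x)\<^sup>2 \<le> Re (cinner (K x) x)"
proof -
  obtain V where "K o\<^sub>L V = id_blinfun"
    using assms(2) by (auto simp: invertible_op_def is_op_inverse_def)
  then have KV: "K (V x) = x" for x
    by (metis blinfun_apply_blinfun_compose blinfun_apply_id_blinfun)
  define N where "N = norm V + 1"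
  have "N > 0" by (simp add: N_def add_nonneg_pos)
  have "1 / N * (norm x)\<^sup>2 \<le> Re (cinner (K x) x)" for x
  proof (cases "x = 0")
    case False
    have "Re (cinner x (V x)) \<le> norm x * norm (V x)"
      using Re_cinner_le_norm [of x "V x"] by simp
    also have "\<dots> \<le> norm x * (norm V * norm x)"
      by (intro mult_left_mono norm_blinfun norm_ge_zero)
    also have "\<dots> \<le> N * (norm x)\<^sup>2"
      by (simp add: N_def power2_eq_square algebra_simps)
    finally have xV: "Re (cinner x (V x)) \<le> N * (norm x)\<^sup>2" .
    have "((norm x)\<^sup>2)\<^sup>2 \<le> Re (cinner x (V x)) * Re (cinner (K x) x)"
      using psd_cauchy_schwarz [OF assms(1), of "V x" x]
      by (simp add: KV norm_squared_eq_cinner)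
    also have "\<dots> \<le> N * (norm x)\<^sup>2 * Re (cinner (K x) x)"
      using assms(1) by (intro mult_right_mono xV) (simp add: positive_semidefinite_def)
    finally have "(norm x)\<^sup>2 * (norm x)\<^sup>2 \<le> (norm x)\<^sup>2 * (N * Re (cinner (K x) x))"
      by (simp add: power2_eq_square mult_ac)
    then have "(norm x)\<^sup>2 \<le> N * Re (cinner (K x) x)"
      by (rule mult_left_le_imp_le) (use False in simp)
    with \<open>N > 0\<close> show ?thesis by (simp add: field_simps)
  qed (simp add: cinner_simps)
  with \<open>N > 0\<close> show thesis by (intro that [of "1 / N"]) auto
qed

text \<open>
  The square of such an operator is coercive, hence invertible, and a commuting factor of an
  invertible operator is invertible.
\<close>

lemma self_adjoint_bounded_below_invertible:
  fixes S :: "'a::complex_hilbert_space \<Rightarrow>\<^sub>L 'a"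
  assumes "self_adjoint S" and "c > 0" and below: "\<And>x. c * norm x \<le> norm (S x)"
  shows "invertible_op S"
proof (rule invertible_op_commuting_factor)
  show "invertible_op (S o\<^sub>L S)"
  proof (rule coercive_invertible)
    show "clinear_op (S o\<^sub>L S)" by (intro clinear_op_compose self_adjoint_clinear assms)
    show "c\<^sup>2 > 0" using assms by simp
    show "c\<^sup>2 * (norm x)\<^sup>2 \<le> Re (cinner ((S o\<^sub>L S) x) x)" for x
      using power_mono [OF below, of x 2] assms(2)
      by (simp add: self_adjointD [OF assms(1)] norm_squared_eq_cinner power_mult_distrib)
  qed
qed (rule refl, rule self_adjoint_clinear [OF assms(1)])

section \<open>The spectrum of a self-adjoint operator\<close>

definition real_spectrum :: "('a::complex_inner \<Rightarrow>\<^sub>L 'a) \<Rightarrow> real set"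
  where "real_spectrum T = {x. complex_of_real x \<in> op_spectrum T}"

lemma scalar_op_of_real:
  "(scalar_op (complex_of_real r) :: 'a::complex_inner \<Rightarrow>\<^sub>L 'a) = r *\<^sub>R id_blinfun"
  by (rule blinfun_eqI) (simp only: scalar_op.rep_eq blinfun.scaleR_left blinfun_apply_id_blinfun scaleR_scaleC [where 'a = 'a])

lemma scalar_op_add: "scalar_op (c + d) = scalar_op c + scalar_op d"
  by (rule blinfun_eqI) (simp add: scalar_op.rep_eq plus_blinfun.rep_eq scaleC_add_left)

lemma scalar_op_mult: "scalar_op (c * d) = scalar_op c o\<^sub>L scalar_op d"
  by (rule blinfun_eqI) (simp add: scalar_op.rep_eq scaleC_scaleC)

lemma scalar_op_minus: "(scalar_op (- c) :: 'a::complex_inner \<Rightarrow>\<^sub>L 'a) = - scalar_op c"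
proof (rule minus_unique [symmetric])
  show "scalar_op c + scalar_op (- c) = (0 :: 'a \<Rightarrow>\<^sub>L 'a)"
    unfolding scalar_op_add [symmetric] using scalar_op_of_real [of 0, where 'a = 'a] by simp
qed

lemma scalar_op_commute: "clinear_op T \<Longrightarrow> scalar_op c o\<^sub>L T = T o\<^sub>L scalar_op c"
  by (rule blinfun_eqI) (simp add: scalar_op.rep_eq clinear_op_def)

lemma real_spectrum_iff: "x \<in> real_spectrum T \<longleftrightarrow> \<not> invertible_op (T - x *\<^sub>R id_blinfun)"
  by (simp add: real_spectrum_def op_spectrum_def scalar_op_of_real)

text \<open>
  The product of \<open>T - scalar_op z\<close> and its conjugate factor is the square of a self-adjoint operator
  plus \<open>(Im z)\<^sup>2\<close>, which is coercive off the real axis.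
\<close>

lemma spectrum_of_self_adjoint_real:
  fixes T :: "'a::complex_hilbert_space \<Rightarrow>\<^sub>L 'a"
  assumes "self_adjoint T" and "z \<in> op_spectrum T"
  shows "z \<in> \<real>"
proof (rule ccontr)
  assume "z \<notin> \<real>"
  then have im: "Im z \<noteq> 0" by (simp add: complex_is_Real_iff)
  note clin = self_adjoint_clinear [OF assms(1)]
  have prod: "(T - scalar_op w) o\<^sub>L (T - scalar_op (cnj w))
      = ((T - Re w *\<^sub>R id_blinfun) o\<^sub>L (T - Re w *\<^sub>R id_blinfun)) + (Im w)\<^sup>2 *\<^sub>R id_blinfun" for w
  proof -
    \<comment> \<open>Both factors are \<open>S - J\<close> and \<open>S + J\<close> with \<open>S\<close> self-adjoint and \<open>J\<close> an imaginary scalar.\<close>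
    define S where "S = T - Re w *\<^sub>R id_blinfun"
    define J where "J = (scalar_op (\<i> * Im w) :: 'a \<Rightarrow>\<^sub>L 'a)"
    have w: "w = of_real (Re w) + \<i> * Im w" and cw: "cnj w + \<i> * Im w = of_real (Re w)"
      by (simp_all add: complex_eq_iff)
    have "scalar_op w = Re w *\<^sub>R id_blinfun + J"
      unfolding J_def by (subst w) (simp only: scalar_op_add scalar_op_of_real)
    then have Sw: "T - scalar_op w = S - J" by (simp add: S_def)
    have "scalar_op (cnj w) + J = Re w *\<^sub>R id_blinfun"
      unfolding J_def scalar_op_add [symmetric] cw by (rule scalar_op_of_real)
    then have Scw: "T - scalar_op (cnj w) = S + J" by (simp add: S_def flip: \<open>scalar_op (cnj w) + J = _\<close>)
    have JJ: "J o\<^sub>L J = - ((Im w)\<^sup>2 *\<^sub>R id_blinfun)"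
    proof -
      have "J o\<^sub>L J = scalar_op (- of_real ((Im w)\<^sup>2))"
        unfolding J_def scalar_op_mult [symmetric]
        by (rule arg_cong [where f = scalar_op]) (simp add: complex_eq_iff power2_eq_square)
      then show ?thesis by (simp only: scalar_op_minus scalar_op_of_real)
    qed
    have "clinear_op S"
      unfolding S_def scalar_op_of_real [symmetric] by (intro clinear_op_diff clin clinear_op_scalar)
    then have JS: "J o\<^sub>L S = S o\<^sub>L J" unfolding J_def by (rule scalar_op_commute)
    have "(S - J) o\<^sub>L (S + J) = (S o\<^sub>L S) - (J o\<^sub>L J)"
      by (simp add: compose_bilinear_simps JS)
    then show ?thesis by (simp add: Sw Scw JJ flip: S_def)
  qed
  have "invertible_op (T - scalar_op z)"
  proof (rule invertible_op_commuting_factor)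
    let ?S = "T - Re z *\<^sub>R id_blinfun"
    have sa: "self_adjoint ?S" by (intro self_adjoint_diff self_adjoint_scaleR self_adjoint_id assms)
    show "invertible_op ((T - scalar_op z) o\<^sub>L (T - scalar_op (cnj z)))"
      unfolding prod
    proof (rule coercive_invertible)
      show "clinear_op ((?S o\<^sub>L ?S) + (Im z)\<^sup>2 *\<^sub>R id_blinfun)"
        by (intro clinear_op_add clinear_op_compose)
          (use sa self_adjoint_scaleR [OF self_adjoint_id] in \<open>auto intro: self_adjoint_clinear\<close>)
      show "(Im z)\<^sup>2 > 0" using im by simp
      fix x
      have form: "Re (cinner ((R + r *\<^sub>R id_blinfun) x) x) = Re (cinner (R x) x) + r * (norm x)\<^sup>2"
        for R :: "'a \<Rightarrow>\<^sub>L 'a" and r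
        by (simp add: cinner_simps norm_squared_eq_cinner)
      have "Re (cinner ((?S o\<^sub>L ?S) x) x) = (norm (?S x))\<^sup>2"
        by (simp add: self_adjointD [OF sa] norm_squared_eq_cinner)
      then show "(Im z)\<^sup>2 * (norm x)\<^sup>2 \<le> Re (cinner (((?S o\<^sub>L ?S) + (Im z)\<^sup>2 *\<^sub>R id_blinfun) x) x)"
        unfolding form by simp
    qed
    show "(T - scalar_op z) o\<^sub>L (T - scalar_op (cnj z)) = (T - scalar_op (cnj z)) o\<^sub>L (T - scalar_op z)"
      using prod [of z] prod [of "cnj z"]
      by (simp only: complex_cnj_cnj complex_cnj power2_minus complex.sel cnj.simps)
    show "clinear_op (T - scalar_op (cnj z))" by (intro clinear_op_diff clin clinear_op_scalar)
  qed
  with assms(2) show False by (simp add: op_spectrum_def)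
qed

lemma real_spectrum_le_norm:
  fixes T :: "'a::complex_hilbert_space \<Rightarrow>\<^sub>L 'a"
  assumes "self_adjoint T" and "x \<in> real_spectrum T"
  shows "\<bar>x\<bar> \<le> norm T"
proof (rule ccontr)
  assume "\<not> \<bar>x\<bar> \<le> norm T"
  then have "\<bar>x\<bar> - norm T > 0" by simp
  moreover have "(\<bar>x\<bar> - norm T) * norm v \<le> norm ((T - x *\<^sub>R id_blinfun) v)" for v
  proof -
    have "\<bar>x\<bar> * norm v - norm T * norm v \<le> norm (x *\<^sub>R v) - norm (T v)"
      using norm_blinfun [of T v] by simp
    also have "\<dots> \<le> norm (x *\<^sub>R v - T v)" by (rule norm_triangle_ineq2)
    also have "\<dots> = norm ((T - x *\<^sub>R id_blinfun) v)"
      by (simp add: blinfun.bilinear_simps norm_minus_commute)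
    finally show ?thesis by (simp only: left_diff_distrib)
  qed
  ultimately have "invertible_op (T - x *\<^sub>R id_blinfun)"
    by (rule self_adjoint_bounded_below_invertible [rotated])
      (intro self_adjoint_diff self_adjoint_scaleR self_adjoint_id assms(1))
  with assms(2) show False by (simp add: real_spectrum_iff)
qed

lemma real_spectrum_ge_coercivity:
  fixes T :: "'a::complex_hilbert_space \<Rightarrow>\<^sub>L 'a"
  assumes "self_adjoint T" and "x \<in> real_spectrum T"
    and "\<And>v. c * (norm v)\<^sup>2 \<le> Re (cinner (T v) v)"
  shows "c \<le> x"
proof (rule ccontr)
  assume "\<not> c \<le> x"
  then have "c - x > 0" by simp
  moreover have "(c - x) * (norm v)\<^sup>2 \<le> Re (cinner ((T - x *\<^sub>R id_blinfun) v) v)" for v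
    using assms(3) [of v] by (simp add: cinner_simps norm_squared_eq_cinner algebra_simps)
  ultimately have "invertible_op (T - x *\<^sub>R id_blinfun)"
    by (rule coercive_invertible [rotated])
      (intro self_adjoint_clinear self_adjoint_diff self_adjoint_scaleR self_adjoint_id assms(1))
  with assms(2) show False by (simp add: real_spectrum_iff)
qed


text \<open>
  The infimum \<open>m\<close> of the numerical range is a spectral value: \<open>S - m\<close> is positive semidefinite, and if
  it were invertible it would be coercive, so that \<open>m\<close> could be increased.
\<close>

lemma exists_spectrum_below:
  fixes S :: "'a::complex_hilbert_space \<Rightarrow>\<^sub>L 'a"
  assumes sa: "self_adjoint S" and "v \<noteq> 0"
  obtains m where "m \<in> real_spectrum S" and "m * (norm v)\<^sup>2 \<le> Re (cinner (S v) v)"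
proof -
  define W where "W = (\<lambda>x. Re (cinner (S x) x)) ` {x. norm x = 1}"
  define m where "m = Inf W"
  have "- norm S \<le> Re (cinner (S x) x)" if "norm x = 1" for x
    using Re_cinner_le_norm [of "S x" x] norm_blinfun [of S x] that by simp
  then have bdd: "bdd_below W" by (auto simp: W_def bdd_below_def)
  have unit: "norm ((1 / norm x) *\<^sub>R x) = 1" if "x \<noteq> 0" for x :: 'a
    using that by simp
  have ne: "W \<noteq> {}" using unit [OF assms(2)] unfolding W_def by blast
  have scale: "Re (cinner (S ((1 / norm x) *\<^sub>R x)) ((1 / norm x) *\<^sub>R x)) * (norm x)\<^sup>2
      = Re (cinner (S x) x)" if "x \<noteq> 0" for x
    using that by (simp add: cinner_simps power2_eq_square)
  have m_le: "m * (norm x)\<^sup>2 \<le> Re (cinner (S x) x)" for x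
  proof (cases "x = 0")
    case False
    have "m \<le> Re (cinner (S ((1 / norm x) *\<^sub>R x)) ((1 / norm x) *\<^sub>R x))"
      unfolding m_def by (rule cInf_lower [OF _ bdd]) (use unit [OF False] in \<open>auto simp: W_def\<close>)
    then have "m * (norm x)\<^sup>2
        \<le> Re (cinner (S ((1 / norm x) *\<^sub>R x)) ((1 / norm x) *\<^sub>R x)) * (norm x)\<^sup>2"
      by (rule mult_right_mono) simp
    then show ?thesis by (simp only: scale [OF False])
  qed (simp add: cinner_simps)
  let ?K = "S - m *\<^sub>R id_blinfun"
  have form: "Re (cinner (?K x) x) = Re (cinner (S x) x) - m * (norm x)\<^sup>2" for x
    by (simp add: cinner_simps norm_squared_eq_cinner)
  have psd: "positive_semidefinite ?K"
    unfolding positive_semidefinite_def form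
    using m_le sa by (auto intro: self_adjoint_diff self_adjoint_scaleR self_adjoint_id)
  have "\<not> invertible_op ?K"
  proof
    assume "invertible_op ?K"
    with psd obtain c where c: "c > 0" "\<And>x. c * (norm x)\<^sup>2 \<le> Re (cinner (?K x) x)"
      by (rule psd_invertible_coercive) blast
    have "m + c \<le> w" if "w \<in> W" for w
    proof -
      obtain x where x: "norm x = 1" "w = Re (cinner (S x) x)" using \<open>w \<in> W\<close> unfolding W_def by blast
      with c(2) [of x] form [of x] show ?thesis by simp
    qed
    then have "m + c \<le> m" unfolding m_def by (rule cInf_greatest [OF ne])
    with c(1) show False by simp
  qed
  then have "m \<in> real_spectrum S" by (simp add: real_spectrum_iff)
  then show thesis by (rule that) (rule m_le)
qed

lemma form_ge_spectrum_bound: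
  fixes S :: "'a::complex_hilbert_space \<Rightarrow>\<^sub>L 'a"
  assumes "self_adjoint S" and "\<And>m. m \<in> real_spectrum S \<Longrightarrow> c \<le> m"
  shows "c * (norm v)\<^sup>2 \<le> Re (cinner (S v) v)"
proof (cases "v = 0")
  case False
  then obtain m where m: "m \<in> real_spectrum S" "m * (norm v)\<^sup>2 \<le> Re (cinner (S v) v)"
    using exists_spectrum_below [OF assms(1)] by blast
  have "c * (norm v)\<^sup>2 \<le> m * (norm v)\<^sup>2"
    by (rule mult_right_mono [OF assms(2) [OF m(1)]]) simp
  with m(2) show ?thesis by simp
qed (simp add: cinner_simps)

section \<open>Polynomials of an operator\<close>

lemma poly_op_eq_sum:
  assumes "degree p \<le> n"
  shows "poly_op p T = (\<Sum>i\<le>n. coeff p i *\<^sub>R (((o\<^sub>L) T ^^ i) id_blinfun))"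
  unfolding poly_op_def
  by (rule sum.mono_neutral_left) (use assms in \<open>auto simp: coeff_eq_0\<close>)

lemma poly_op_0 [simp]: "poly_op 0 T = 0"
  by (simp add: poly_op_def)

lemma poly_op_add: "poly_op (p + q) T = poly_op p T + poly_op q T"
proof -
  let ?n = "max (degree p) (degree q)"
  have "degree (p + q) \<le> ?n" by (rule degree_add_le_max)
  then show ?thesis
    by (simp add: poly_op_eq_sum [of _ ?n] scaleR_add_left sum.distrib)
qed

lemma poly_op_smult: "poly_op (smult c p) T = c *\<^sub>R poly_op p T"
  by (simp add: poly_op_eq_sum [of _ "degree p"] scaleR_sum_right)

lemma poly_op_diff: "poly_op (p - q) T = poly_op p T - poly_op q T"
  using poly_op_add [of "p - q" q T] by simp

lemma poly_op_pCons: "poly_op (pCons c p) T = c *\<^sub>R id_blinfun + (T o\<^sub>L poly_op p T)"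
proof -
  have "poly_op (pCons c p) T
      = (\<Sum>i\<le>Suc (degree p). coeff (pCons c p) i *\<^sub>R (((o\<^sub>L) T ^^ i) id_blinfun))"
    by (rule poly_op_eq_sum) (rule degree_pCons_le)
  also have "\<dots> = c *\<^sub>R id_blinfun
      + (\<Sum>i\<le>degree p. coeff p i *\<^sub>R (T o\<^sub>L (((o\<^sub>L) T ^^ i) id_blinfun)))"
    by (subst sum.atMost_Suc_shift) simp
  also have "(\<Sum>i\<le>degree p. coeff p i *\<^sub>R (T o\<^sub>L (((o\<^sub>L) T ^^ i) id_blinfun))) = T o\<^sub>L poly_op p T"
    by (simp add: poly_op_def bounded_bilinear.sum_right [OF bounded_bilinear_blinfun_compose]
        compose_bilinear_simps)
  finally show ?thesis .
qed

lemma poly_op_const: "poly_op [:c:] T = c *\<^sub>R id_blinfun"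
  by (simp add: poly_op_pCons)

lemma poly_op_mult: "poly_op (p * q) T = poly_op p T o\<^sub>L poly_op q T"
  by (induction p)
    (simp_all add: poly_op_add poly_op_smult poly_op_pCons compose_bilinear_simps
      blinfun_compose_assoc)

lemma poly_op_intertwine:
  assumes "X o\<^sub>L T = S o\<^sub>L X"
  shows "X o\<^sub>L poly_op p T = poly_op p S o\<^sub>L X"
proof (induction p)
  case (pCons c p)
  have "X o\<^sub>L (T o\<^sub>L poly_op p T) = (S o\<^sub>L X) o\<^sub>L poly_op p T"
    by (simp only: assms [symmetric] blinfun_compose_assoc)
  also have "\<dots> = S o\<^sub>L (poly_op p S o\<^sub>L X)"
    by (simp only: pCons.IH blinfun_compose_assoc)
  finally show ?case
    by (simp add: poly_op_pCons compose_bilinear_simps blinfun_compose_assoc)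
qed simp

lemma self_adjoint_poly_op:
  assumes "self_adjoint T"
  shows "self_adjoint (poly_op p T)"
proof (induction p)
  case 0
  show ?case by (simp add: self_adjoint_zero)
next
  case (pCons c p)
  have "T o\<^sub>L poly_op p T = poly_op p T o\<^sub>L T" by (rule poly_op_intertwine) simp
  with pCons.IH assms have "self_adjoint (T o\<^sub>L poly_op p T)"
    using adjoint_pair_compose [of T T "poly_op p T" "poly_op p T"]
    by (simp add: self_adjoint_iff_adjoint_pair)
  then show ?case
    by (simp add: poly_op_pCons self_adjoint_add self_adjoint_scaleR self_adjoint_id)
qed

text \<open>
  Complex coefficients allow a real polynomial to be split into linear factors.
\<close>

definition complex_poly_op :: "complex poly \<Rightarrow> ('a::complex_inner \<Rightarrow>\<^sub>L 'a) \<Rightarrow> ('a \<Rightarrow>\<^sub>L 'a)"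
  where "complex_poly_op p T = fold_coeffs (\<lambda>c S. scalar_op c + (T o\<^sub>L S)) p 0"

lemma scalar_op_0 [simp]: "scalar_op 0 = 0"
  using scalar_op_add [of 0 0] by simp

lemma complex_poly_op_0 [simp]: "complex_poly_op 0 T = 0"
  by (simp add: complex_poly_op_def)

lemma complex_poly_op_pCons:
  "complex_poly_op (pCons c p) T = scalar_op c + (T o\<^sub>L complex_poly_op p T)"
  by (cases "c = 0 \<and> p = 0") (auto simp: complex_poly_op_def)

lemma complex_poly_op_add:
  "complex_poly_op (p + q) T = complex_poly_op p T + complex_poly_op q T"
  by (induction p q rule: poly_induct2)
    (simp_all add: complex_poly_op_pCons scalar_op_add compose_bilinear_simps)

lemma complex_poly_op_smult:
  assumes "clinear_op T"
  shows "complex_poly_op (smult c p) T = scalar_op c o\<^sub>L complex_poly_op p T"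
proof (induction p)
  case (pCons d p)
  have "T o\<^sub>L (scalar_op c o\<^sub>L X) = scalar_op c o\<^sub>L (T o\<^sub>L X)" for X
    by (simp only: scalar_op_commute [OF assms] flip: blinfun_compose_assoc)
  with pCons.IH show ?case
    by (simp add: complex_poly_op_pCons scalar_op_mult compose_bilinear_simps)
qed simp

lemma complex_poly_op_linear_factor:
  assumes "clinear_op T"
  shows "complex_poly_op ([:- z, 1:] * p) T = (T - scalar_op z) o\<^sub>L complex_poly_op p T"
  by (simp add: complex_poly_op_add complex_poly_op_smult [OF assms] complex_poly_op_pCons
      compose_bilinear_simps scalar_op_minus del: smult_minus_left)

lemma complex_poly_op_of_real: "complex_poly_op (map_poly of_real p) T = poly_op p T"
  by (induction p)
    (simp_all add: map_poly_pCons complex_poly_op_pCons poly_op_pCons scalar_op_of_real)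

text \<open>
  By the fundamental theorem of algebra the operator is a product of a nonzero scalar and factors
  \<open>T - scalar_op z\<close> with \<open>z\<close> outside the spectrum.
\<close>

lemma complex_poly_op_invertible:
  assumes "clinear_op T" and "p \<noteq> 0" and "\<And>z. poly p z = 0 \<Longrightarrow> z \<notin> op_spectrum T"
  shows "invertible_op (complex_poly_op p T)"
  using assms(2,3)
proof (induction "degree p" arbitrary: p)
  case 0
  then obtain c where p: "p = [:c:]" by (auto elim: degree_eq_zeroE)
  with 0 have c: "c \<noteq> 0" by simp
  have "scalar_op 1 = id_blinfun" using scalar_op_of_real [of 1] by simp
  then have "is_op_inverse (scalar_op c) (scalar_op (inverse c))"
    using c by (simp add: is_op_inverse_def clinear_op_scalar flip: scalar_op_mult)
  then show ?case by (auto simp: p complex_poly_op_pCons invertible_op_def)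
next
  case (Suc n)
  then have "\<not> constant (poly p)" by (simp add: constant_degree)
  then obtain z where z: "poly p z = 0" using fundamental_theorem_of_algebra by blast
  then obtain q where q: "p = [:- z, 1:] * q" by (auto simp: poly_eq_0_iff_dvd elim: dvdE)
  with Suc.prems have "q \<noteq> 0" by auto
  have "degree p = Suc (degree q)" unfolding q using \<open>q \<noteq> 0\<close> by (subst degree_mult_eq) auto
  with Suc.hyps(2) have "n = degree q" by simp
  moreover have "w \<notin> op_spectrum T" if "poly q w = 0" for w
    using that by (intro Suc.prems(2)) (simp add: q)
  ultimately have "invertible_op (complex_poly_op q T)" using \<open>q \<noteq> 0\<close> Suc.hyps(1) by blast
  moreover have "invertible_op (T - scalar_op z)"
    using Suc.prems(2) [OF z] by (simp add: op_spectrum_def)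
  ultimately show ?case
    unfolding q complex_poly_op_linear_factor [OF assms(1)] by (intro invertible_op_compose)
qed

lemma poly_map_poly_of_real:
  "poly (map_poly of_real p) (complex_of_real x) = complex_of_real (poly p x)"
  by (induction p) (simp_all add: map_poly_pCons)

text \<open>
  The half of the spectral mapping theorem that makes bounds on the spectrum of \<open>T\<close> bounds on
  polynomials of \<open>T\<close>.  If \<open>p\<close> misses the value \<open>m\<close> on the spectrum, then \<open>p - m\<close> has no root
  there, and its value at \<open>T\<close> is invertible.
\<close>

lemma real_spectrum_poly_op:
  fixes T :: "'a::complex_hilbert_space \<Rightarrow>\<^sub>L 'a"
  assumes "self_adjoint T" and "m \<in> real_spectrum (poly_op p T)"
  shows "\<exists>x \<in> real_spectrum T. poly p x = m"
proof (rule ccontr)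
  assume no: "\<not> (\<exists>x \<in> real_spectrum T. poly p x = m)"
  let ?q = "p - [:m:]"
  have q: "poly_op ?q T = poly_op p T - m *\<^sub>R id_blinfun"
    by (simp only: poly_op_diff poly_op_const)
  have not_inv: "\<not> invertible_op (poly_op ?q T)"
    unfolding q using assms(2) by (simp only: real_spectrum_iff not_False_eq_True)
  have "?q \<noteq> 0"
  proof
    assume "?q = 0"
    then have p: "p = [:m:]" by simp
    \<comment> \<open>On the zero space every operator is invertible, so there is a nonzero vector, and hence a
      spectral value of \<open>T\<close>, at which the constant \<open>p\<close> takes the value \<open>m\<close>.\<close>
    have "\<exists>v :: 'a. v \<noteq> 0"
    proof (rule ccontr)
      assume "\<nexists>v :: 'a. v \<noteq> 0"
      then have z: "x = y" for x y :: 'a by (metis (full_types))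
      then have "is_op_inverse (poly_op ?q T) (0 :: 'a \<Rightarrow>\<^sub>L 'a)"
        unfolding is_op_inverse_def clinear_op_def by (intro conjI allI blinfun_eqI z)
      with not_inv show False by (auto simp: invertible_op_def)
    qed
    then obtain v :: 'a where "v \<noteq> 0" by blast
    with assms(1) obtain x where "x \<in> real_spectrum T" by (rule exists_spectrum_below)
    with no p show False by auto
  qed
  have "z \<notin> op_spectrum T" if z: "poly (map_poly of_real ?q) z = 0" for z
  proof
    assume zT: "z \<in> op_spectrum T"
    with assms(1) have "z \<in> \<real>" by (rule spectrum_of_self_adjoint_real)
    then obtain x where x: "z = complex_of_real x" by (auto elim: Reals_cases)
    have "poly ?q x = 0"
      using z unfolding x by (simp only: poly_map_poly_of_real of_real_eq_0_iff)
    moreover have "x \<in> real_spectrum T" using zT by (simp add: x real_spectrum_def)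
    ultimately show False using no by auto
  qed
  moreover have "map_poly complex_of_real ?q \<noteq> 0"
    using \<open>?q \<noteq> 0\<close> by (simp only: map_poly_eq_0_iff of_real_eq_0_iff of_real_0 not_False_eq_True)
  ultimately have "invertible_op (complex_poly_op (map_poly of_real ?q) T)"
    by (intro complex_poly_op_invertible self_adjoint_clinear assms(1))
  with not_inv show False by (simp only: complex_poly_op_of_real)
qed

lemma poly_op_form_ge:
  fixes T :: "'a::complex_hilbert_space \<Rightarrow>\<^sub>L 'a"
  assumes "self_adjoint T" and "\<And>x. x \<in> real_spectrum T \<Longrightarrow> c \<le> poly p x"
  shows "c * (norm v)\<^sup>2 \<le> Re (cinner (poly_op p T v) v)"
  by (rule form_ge_spectrum_bound [OF self_adjoint_poly_op [OF assms(1)]])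
    (use real_spectrum_poly_op [OF assms(1)] assms(2) in blast)

text \<open>
  The square of \<open>norm (poly_op p T v)\<close> is the form of \<open>poly_op (p * p) T\<close> at \<open>v\<close>, and \<open>p * p\<close> is
  bounded by \<open>c\<^sup>2\<close> on the spectrum.
\<close>

lemma poly_op_norm_le:
  fixes T :: "'a::complex_hilbert_space \<Rightarrow>\<^sub>L 'a"
  assumes "self_adjoint T" and "0 \<le> c" and "\<And>x. x \<in> real_spectrum T \<Longrightarrow> \<bar>poly p x\<bar> \<le> c"
  shows "norm (poly_op p T) \<le> c"
proof (rule norm_blinfun_bound [OF assms(2)])
  fix v
  have "- (c\<^sup>2) * (norm v)\<^sup>2 \<le> Re (cinner (poly_op (- (p * p)) T v) v)"
    by (rule poly_op_form_ge [OF assms(1)])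
      (use assms in \<open>simp add: abs_le_square_iff [symmetric] flip: power2_eq_square\<close>)
  also have "poly_op (- (p * p)) T = - (poly_op p T o\<^sub>L poly_op p T)"
    using poly_op_diff [of 0 "p * p" T] by (simp add: poly_op_mult)
  finally have "(norm (poly_op p T v))\<^sup>2 \<le> (c * norm v)\<^sup>2"
    by (simp add: cinner_simps self_adjointD [OF self_adjoint_poly_op [OF assms(1)]]
        norm_squared_eq_cinner power_mult_distrib)
  then show "norm (poly_op p T v) \<le> c * norm v"
    by (rule power2_le_imp_le) (simp add: assms(2))
qed

section \<open>Functional calculus on the positive cone\<close>

lemma pd_psd: "positive_definite T \<Longrightarrow> positive_semidefinite T"
  and pd_invertible: "positive_definite T \<Longrightarrow> invertible_op T"
  and pd_self_adjoint: "positive_definite T \<Longrightarrow> self_adjoint T"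
  and psd_form_nonneg: "positive_semidefinite T \<Longrightarrow> 0 \<le> Re (cinner (T x) x)"
  by (simp_all add: positive_definite_def positive_semidefinite_def)

lemma coercive_pd:
  fixes T :: "'a::complex_hilbert_space \<Rightarrow>\<^sub>L 'a"
  assumes "self_adjoint T" and "c > 0" and "\<And>x. c * (norm x)\<^sup>2 \<le> Re (cinner (T x) x)"
  shows "positive_definite T"
proof -
  have "0 \<le> Re (cinner (T x) x)" for x
    using assms(2) order_trans [OF _ assms(3) [of x], of 0] by simp
  moreover have "invertible_op T"
    using assms by (intro coercive_invertible [of T c]) (auto intro: self_adjoint_clinear)
  ultimately show ?thesis using assms(1) by (simp add: positive_definite_def positive_semidefinite_def)
qed

lemma pd_real_spectrum_bounds:
  fixes T :: "'a::complex_hilbert_space \<Rightarrow>\<^sub>L 'a"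
  assumes "positive_definite T"
  obtains a b where "0 < a" and "real_spectrum T \<subseteq> {a..b}"
proof -
  obtain a where "a > 0" "\<And>x. a * (norm x)\<^sup>2 \<le> Re (cinner (T x) x)"
    using psd_invertible_coercive [OF pd_psd pd_invertible, OF assms assms] by blast
  moreover from this have "a \<le> x \<and> x \<le> norm T" if "x \<in> real_spectrum T" for x
    using real_spectrum_ge_coercivity [OF pd_self_adjoint [OF assms] that]
      real_spectrum_le_norm [OF pd_self_adjoint [OF assms] that] by auto
  ultimately show thesis by (intro that [of a "norm T"]) auto
qed

lemma pd_real_spectrum_pos:
  fixes T :: "'a::complex_hilbert_space \<Rightarrow>\<^sub>L 'a"
  assumes "positive_definite T" and "x \<in> real_spectrum T"
  shows "0 < x"
  using pd_real_spectrum_bounds [OF assms(1)] assms(2)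
  by (metis atLeastAtMost_iff less_le_trans subsetD)

lemma uniform_limit_polynomials:
  fixes f :: "real \<Rightarrow> real"
  assumes "continuous_on {0<..} f" and "0 < a"
  obtains p :: "nat \<Rightarrow> real poly" where "uniform_limit {a..b} (\<lambda>n. poly (p n)) f sequentially"
proof -
  have "\<exists>p :: real poly. \<forall>x \<in> {a..b}. \<bar>f x - poly p x\<bar> < e" if "e > 0" for e
  proof -
    have "continuous_on {a..b} f"
      by (rule continuous_on_subset [OF assms(1)]) (use assms(2) in auto)
    then obtain g where g: "real_polynomial_function g" "\<And>x. x \<in> {a..b} \<Longrightarrow> \<bar>f x - g x\<bar> < e"
      using Stone_Weierstrass_real_polynomial_function [OF compact_Icc _ \<open>e > 0\<close>, of a b f] by blast
    obtain c n where "g = (\<lambda>x. \<Sum>i\<le>n. c i * x ^ i)"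
      using g(1) by (auto simp: real_polynomial_function_iff_sum)
    then have "poly (\<Sum>i\<le>n. monom (c i) i) x = g x" for x
      by (simp add: poly_sum poly_monom)
    with g(2) show ?thesis by metis
  qed
  then have "\<forall>n. \<exists>p :: real poly. \<forall>x \<in> {a..b}. \<bar>f x - poly p x\<bar> < inverse (real (Suc n))"
    by simp
  then obtain p :: "nat \<Rightarrow> real poly"
    where p: "\<And>n x. x \<in> {a..b} \<Longrightarrow> \<bar>f x - poly (p n) x\<bar> < inverse (real (Suc n))"
    by metis
  have "uniform_limit {a..b} (\<lambda>n. poly (p n)) f sequentially"
  proof (rule uniform_limitI)
    fix e :: real
    assume "e > 0"
    with LIMSEQ_inverse_real_of_nat have "\<forall>\<^sub>F n in sequentially. inverse (real (Suc n)) < e"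
      by (rule order_tendstoD)
    then show "\<forall>\<^sub>F n in sequentially. \<forall>x\<in>{a..b}. dist (poly (p n) x) (f x) < e"
    proof eventually_elim
      case (elim n)
      with p [of _ n] show ?case by (fastforce simp: dist_real_def abs_minus_commute)
    qed
  qed
  then show thesis by (rule that)
qed

text \<open>
  Polynomials that are uniformly close on the spectrum have values that are close in operator norm.
  So the values along one approximating sequence form a Cauchy sequence, any other approximating
  sequence has the same limit, and the definite description in the definition of the functional
  calculus is satisfied by exactly that limit.
\<close>

lemma func_calc_limit:
  fixes T :: "'a::complex_hilbert_space \<Rightarrow>\<^sub>L 'a"
  assumes pd: "positive_definite T" and f: "continuous_on {0<..} f"
    and p: "uniform_limit (real_spectrum T) (\<lambda>n. poly (p n)) f sequentially"
  shows "(\<lambda>n. poly_op (p n) T) \<longlonglongrightarrow> func_calc f T"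
proof -
  note sa = pd_self_adjoint [OF pd]
  obtain a b where ab: "0 < a" "real_spectrum T \<subseteq> {a..b}"
    using pd_real_spectrum_bounds [OF pd] by blast
  have diff: "\<forall>\<^sub>F n in sequentially. \<forall>\<^sub>F m in sequentially.
      norm (poly_op (q n) T - poly_op (r m) T) \<le> e"
    if q: "uniform_limit (real_spectrum T) (\<lambda>n. poly (q n)) f sequentially"
      and r: "uniform_limit (real_spectrum T) (\<lambda>n. poly (r n)) f sequentially"
      and "e > 0" for q r :: "nat \<Rightarrow> real poly" and e
  proof -
    from \<open>e > 0\<close> have "e / 2 > 0" by simp
    from uniform_limitD [OF r this] have ev: "\<forall>\<^sub>F m in sequentially. \<forall>x\<in>real_spectrum T.
        dist (poly (r m) x) (f x) < e / 2" .
    from uniform_limitD [OF q \<open>e / 2 > 0\<close>] show ?thesis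
    proof eventually_elim
      case (elim n)
      from ev show ?case
      proof eventually_elim
        case (elim m)
        have "\<bar>poly (q n - r m) x\<bar> \<le> e" if "x \<in> real_spectrum T" for x
        proof -
          have "dist (poly (q n) x) (f x) < e / 2" "dist (poly (r m) x) (f x) < e / 2"
            using that elim \<open>\<forall>x\<in>real_spectrum T. dist (poly (q n) x) (f x) < e / 2\<close> by auto
          then show ?thesis unfolding dist_real_def poly_diff by linarith
        qed
        then show ?case
          using poly_op_norm_le [OF sa, of e "q n - r m"] \<open>e > 0\<close> by (simp add: poly_op_diff)
      qed
    qed
  qed
  obtain q where "uniform_limit {a..b} (\<lambda>n. poly (q n)) f sequentially"
    using uniform_limit_polynomials [OF f ab(1)] by blast
  then have q: "uniform_limit (real_spectrum T) (\<lambda>n. poly (q n)) f sequentially"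
    by (rule uniform_limit_on_subset) (rule ab(2))
  have "Cauchy (\<lambda>n. poly_op (q n) T)"
  proof (rule metric_CauchyI)
    fix e :: real
    assume "e > 0"
    then have "e / 4 > 0" by simp
    from eventually_happens [OF diff [OF q q this]] obtain n where
      "\<forall>\<^sub>F m in sequentially. norm (poly_op (q n) T - poly_op (q m) T) \<le> e / 4"
      by auto
    then obtain N where N: "\<And>m. m \<ge> N \<Longrightarrow> norm (poly_op (q n) T - poly_op (q m) T) \<le> e / 4"
      by (auto simp: eventually_sequentially)
    have "dist (poly_op (q k) T) (poly_op (q m) T) < e" if "k \<ge> N" "m \<ge> N" for k m
      using dist_triangle3 [of "poly_op (q k) T" "poly_op (q m) T" "poly_op (q n) T"]
        N [OF that(1)] N [OF that(2)] \<open>e > 0\<close> unfolding dist_norm by linarith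
    then show "\<exists>M. \<forall>m\<ge>M. \<forall>n\<ge>M. dist (poly_op (q m) T) (poly_op (q n) T) < e" by blast
  qed
  then obtain X where X: "(\<lambda>n. poly_op (q n) T) \<longlonglongrightarrow> X"
    by (auto simp: Cauchy_convergent_iff convergent_def)
  have all: "(\<lambda>n. poly_op (r n) T) \<longlonglongrightarrow> X"
    if r: "uniform_limit (real_spectrum T) (\<lambda>n. poly (r n)) f sequentially" for r
  proof (rule metric_LIMSEQ_I)
    fix e :: real
    assume "e > 0"
    then have "e / 2 > 0" by simp
    from diff [OF r q this] have "\<forall>\<^sub>F n in sequentially. norm (poly_op (r n) T - X) \<le> e / 2"
    proof eventually_elim
      case (elim n)
      have "(\<lambda>m. norm (poly_op (r n) T - poly_op (q m) T)) \<longlonglongrightarrow> norm (poly_op (r n) T - X)"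
        by (intro tendsto_intros X)
      then show ?case by (rule tendsto_upperbound) (use elim in auto)
    qed
    then have "\<forall>\<^sub>F n in sequentially. dist (poly_op (r n) T) X < e"
      by eventually_elim (use \<open>e > 0\<close> in \<open>simp add: dist_norm\<close>)
    then show "\<exists>N. \<forall>n\<ge>N. dist (poly_op (r n) T) X < e" by (simp add: eventually_sequentially)
  qed
  have "func_calc f T = X"
    unfolding func_calc_def real_spectrum_def [symmetric]
  proof (rule the_equality)
    show "\<forall>p. uniform_limit (real_spectrum T) (\<lambda>n. poly (p n)) f sequentially \<longrightarrow>
      (\<lambda>n. poly_op (p n) T) \<longlonglongrightarrow> X" using all by blast
    fix Y
    assume "\<forall>p. uniform_limit (real_spectrum T) (\<lambda>n. poly (p n)) f sequentially \<longrightarrow>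
      (\<lambda>n. poly_op (p n) T) \<longlonglongrightarrow> Y"
    with q have "(\<lambda>n. poly_op (q n) T) \<longlonglongrightarrow> Y" by blast
    with X show "Y = X" by (blast intro: LIMSEQ_unique)
  qed
  with all [OF p] show ?thesis by simp
qed

text \<open>
  The same polynomials serve two operators, because they may be chosen on an interval that contains
  both spectra.  This is what makes \<open>func_calc_intertwine\<close> a statement about polynomials.
\<close>

lemma func_calc_common_approximation:
  fixes S T :: "'a::complex_hilbert_space \<Rightarrow>\<^sub>L 'a"
  assumes "positive_definite S" and "positive_definite T" and f: "continuous_on {0<..} f"
  obtains p where "(\<lambda>n. poly_op (p n) S) \<longlonglongrightarrow> func_calc f S"
    and "(\<lambda>n. poly_op (p n) T) \<longlonglongrightarrow> func_calc f T"
    and "uniform_limit (real_spectrum T) (\<lambda>n. poly (p n)) f sequentially"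
proof -
  obtain a b where S: "0 < a" "real_spectrum S \<subseteq> {a..b}"
    using pd_real_spectrum_bounds [OF assms(1)] by blast
  obtain c d where T: "0 < c" "real_spectrum T \<subseteq> {c..d}"
    using pd_real_spectrum_bounds [OF assms(2)] by blast
  obtain p where p: "uniform_limit {min a c..max b d} (\<lambda>n. poly (p n)) f sequentially"
    using uniform_limit_polynomials [OF f, of "min a c"] S T by auto
  have "uniform_limit (real_spectrum S) (\<lambda>n. poly (p n)) f sequentially"
    "uniform_limit (real_spectrum T) (\<lambda>n. poly (p n)) f sequentially"
    by (rule uniform_limit_on_subset [OF p]; use S T in force)+
  then show thesis using assms by (intro that func_calc_limit)
qed

lemma self_adjoint_func_calc:
  fixes T :: "'a::complex_hilbert_space \<Rightarrow>\<^sub>L 'a"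
  assumes "positive_definite T" and "continuous_on {0<..} f"
  shows "self_adjoint (func_calc f T)"
proof -
  obtain p where "(\<lambda>n. poly_op (p n) T) \<longlonglongrightarrow> func_calc f T"
    using func_calc_common_approximation [OF assms(1,1,2)] by blast
  then show ?thesis
    by (rule self_adjoint_limit [rotated]) (rule self_adjoint_poly_op [OF pd_self_adjoint [OF assms(1)]])
qed

text \<open>
  Taking \<open>X\<close> with \<open>T = Y o\<^sub>L X\<close> and \<open>S = X o\<^sub>L Y\<close> gives \<open>X o\<^sub>L f(Y o\<^sub>L X) = f(X o\<^sub>L Y) o\<^sub>L X\<close>, the rule
  that moves powers past a factor in the computations with geometric means.
\<close>

lemma func_calc_intertwine:
  fixes S T X :: "'a::complex_hilbert_space \<Rightarrow>\<^sub>L 'a"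
  assumes "positive_definite S" and "positive_definite T" and "continuous_on {0<..} f"
    and "X o\<^sub>L T = S o\<^sub>L X"
  shows "X o\<^sub>L func_calc f T = func_calc f S o\<^sub>L X"
proof -
  obtain p where p: "(\<lambda>n. poly_op (p n) S) \<longlonglongrightarrow> func_calc f S"
    "(\<lambda>n. poly_op (p n) T) \<longlonglongrightarrow> func_calc f T"
    using func_calc_common_approximation [OF assms(1-3)] by blast
  have "(\<lambda>n. X o\<^sub>L poly_op (p n) T) \<longlonglongrightarrow> (X o\<^sub>L func_calc f T)"
    by (intro bounded_bilinear.tendsto [OF bounded_bilinear_blinfun_compose] tendsto_const p)
  moreover have "(\<lambda>n. X o\<^sub>L poly_op (p n) T) \<longlonglongrightarrow> (func_calc f S o\<^sub>L X)"
    unfolding poly_op_intertwine [OF assms(4)]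
    by (intro bounded_bilinear.tendsto [OF bounded_bilinear_blinfun_compose] tendsto_const p)
  ultimately show ?thesis by (rule LIMSEQ_unique)
qed

lemma func_calc_cong:
  fixes T :: "'a::complex_hilbert_space \<Rightarrow>\<^sub>L 'a"
  assumes "positive_definite T" and "\<And>x. x > 0 \<Longrightarrow> f x = g x"
  shows "func_calc f T = func_calc g T"
proof -
  have "uniform_limit (real_spectrum T) (\<lambda>n. poly (p n)) f sequentially
      \<longleftrightarrow> uniform_limit (real_spectrum T) (\<lambda>n. poly (p n)) g sequentially" for p :: "nat \<Rightarrow> real poly"
    by (rule uniform_limit_cong')
      (use assms(2) pd_real_spectrum_pos [OF assms(1)] in auto)
  then show ?thesis by (simp add: func_calc_def flip: real_spectrum_def)
qed

lemma func_calc_poly: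
  fixes T :: "'a::complex_hilbert_space \<Rightarrow>\<^sub>L 'a"
  assumes "positive_definite T"
  shows "func_calc (poly p) T = poly_op p T"
proof (rule LIMSEQ_unique)
  show "(\<lambda>n::nat. poly_op p T) \<longlonglongrightarrow> func_calc (poly p) T"
    by (rule func_calc_limit [OF assms])
      (auto intro: uniform_limit_const continuous_intros)
qed (rule tendsto_const)

lemma bounded_image_real_spectrum:
  fixes T :: "'a::complex_hilbert_space \<Rightarrow>\<^sub>L 'a"
  assumes "positive_definite T" and "continuous_on {0<..} f"
  shows "bounded (f ` real_spectrum T)"
proof -
  obtain a b where ab: "0 < a" "real_spectrum T \<subseteq> {a..b}"
    using pd_real_spectrum_bounds [OF assms(1)] by blast
  have "compact (f ` {a..b})"
    by (intro compact_continuous_image continuous_on_subset [OF assms(2)]) (use ab in auto)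
  then show ?thesis
    using ab(2) by (blast intro: bounded_subset compact_imp_bounded)
qed

lemma func_calc_mult:
  fixes T :: "'a::complex_hilbert_space \<Rightarrow>\<^sub>L 'a"
  assumes pd: "positive_definite T" and f: "continuous_on {0<..} f" and g: "continuous_on {0<..} g"
  shows "func_calc f T o\<^sub>L func_calc g T = func_calc (\<lambda>x. f x * g x) T"
proof -
  obtain p where p: "(\<lambda>n. poly_op (p n) T) \<longlonglongrightarrow> func_calc f T"
    "uniform_limit (real_spectrum T) (\<lambda>n. poly (p n)) f sequentially"
    using func_calc_common_approximation [OF pd pd f] by blast
  obtain q where q: "(\<lambda>n. poly_op (q n) T) \<longlonglongrightarrow> func_calc g T"
    "uniform_limit (real_spectrum T) (\<lambda>n. poly (q n)) g sequentially"
    using func_calc_common_approximation [OF pd pd g] by blast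
  have "uniform_limit (real_spectrum T) (\<lambda>n x. poly (p n) x * poly (q n) x) (\<lambda>x. f x * g x) sequentially"
    by (intro uniform_lim_mult p q bounded_image_real_spectrum pd f g)
  then have "(\<lambda>n. poly_op (p n * q n) T) \<longlonglongrightarrow> func_calc (\<lambda>x. f x * g x) T"
    by (intro func_calc_limit pd continuous_intros f g) (simp add: poly_mult [abs_def])
  moreover have "(\<lambda>n. poly_op (p n * q n) T) \<longlonglongrightarrow> (func_calc f T o\<^sub>L func_calc g T)"
    unfolding poly_op_mult by (intro bounded_bilinear.tendsto [OF bounded_bilinear_blinfun_compose] p q)
  ultimately show ?thesis by (blast intro: LIMSEQ_unique)
qed

lemma func_calc_add:
  fixes T :: "'a::complex_hilbert_space \<Rightarrow>\<^sub>L 'a"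
  assumes pd: "positive_definite T" and f: "continuous_on {0<..} f" and g: "continuous_on {0<..} g"
  shows "func_calc (\<lambda>x. f x + g x) T = func_calc f T + func_calc g T"
proof -
  obtain p where p: "(\<lambda>n. poly_op (p n) T) \<longlonglongrightarrow> func_calc f T"
    "uniform_limit (real_spectrum T) (\<lambda>n. poly (p n)) f sequentially"
    using func_calc_common_approximation [OF pd pd f] by blast
  obtain q where q: "(\<lambda>n. poly_op (q n) T) \<longlonglongrightarrow> func_calc g T"
    "uniform_limit (real_spectrum T) (\<lambda>n. poly (q n)) g sequentially"
    using func_calc_common_approximation [OF pd pd g] by blast
  have "uniform_limit (real_spectrum T) (\<lambda>n x. poly (p n) x + poly (q n) x) (\<lambda>x. f x + g x) sequentially"
    by (intro uniform_limit_add p q)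
  then have "(\<lambda>n. poly_op (p n + q n) T) \<longlonglongrightarrow> func_calc (\<lambda>x. f x + g x) T"
    by (intro func_calc_limit pd continuous_intros f g) (simp add: poly_add [abs_def])
  moreover have "(\<lambda>n. poly_op (p n + q n) T) \<longlonglongrightarrow> func_calc f T + func_calc g T"
    unfolding poly_op_add by (intro tendsto_add p q)
  ultimately show ?thesis by (blast intro: LIMSEQ_unique)
qed

lemma func_calc_const:
  fixes T :: "'a::complex_hilbert_space \<Rightarrow>\<^sub>L 'a"
  assumes "positive_definite T"
  shows "func_calc (\<lambda>x. c) T = c *\<^sub>R id_blinfun"
proof -
  have "poly [:c:] = (\<lambda>x. c)" by (rule ext) simp
  then show ?thesis using func_calc_poly [OF assms, of "[:c:]"] by (simp only: poly_op_const)
qed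

lemma func_calc_diff:
  fixes T :: "'a::complex_hilbert_space \<Rightarrow>\<^sub>L 'a"
  assumes pd: "positive_definite T" and f: "continuous_on {0<..} f" and g: "continuous_on {0<..} g"
  shows "func_calc (\<lambda>x. f x - g x) T = func_calc f T - func_calc g T"
  using func_calc_add [OF pd _ g, of "\<lambda>x. f x - g x"] f g
  by (simp add: continuous_on_diff)

text \<open>
  Approximating polynomials are at least \<open>c - e\<close> on the spectrum, so the bound holds with \<open>c - e\<close> in
  place of \<open>c\<close> for every positive \<open>e\<close>.
\<close>

lemma func_calc_form_ge:
  fixes T :: "'a::complex_hilbert_space \<Rightarrow>\<^sub>L 'a"
  assumes pd: "positive_definite T" and f: "continuous_on {0<..} f"
    and ge: "\<And>x. x \<in> real_spectrum T \<Longrightarrow> c \<le> f x"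
  shows "c * (norm v)\<^sup>2 \<le> Re (cinner (func_calc f T v) v)"
proof -
  obtain p where p: "(\<lambda>n. poly_op (p n) T) \<longlonglongrightarrow> func_calc f T"
    "uniform_limit (real_spectrum T) (\<lambda>n. poly (p n)) f sequentially"
    using func_calc_common_approximation [OF pd pd f] by blast
  have "(c - e) * (norm v)\<^sup>2 \<le> Re (cinner (func_calc f T v) v)" if "e > 0" for e
  proof (rule tendsto_lowerbound)
    show "(\<lambda>n. Re (cinner (poly_op (p n) T v) v)) \<longlonglongrightarrow> Re (cinner (func_calc f T v) v)"
      by (intro tendsto_Re cinner.tendsto blinfun.tendsto tendsto_const p)
    from uniform_limitD [OF p(2) that]
    show "\<forall>\<^sub>F n in sequentially. (c - e) * (norm v)\<^sup>2 \<le> Re (cinner (poly_op (p n) T v) v)"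
    proof eventually_elim
      case (elim n)
      have "c - e \<le> poly (p n) x" if "x \<in> real_spectrum T" for x
        using ge [OF that] elim that by (force simp: dist_real_def)
      then show ?case by (rule poly_op_form_ge [OF pd_self_adjoint [OF pd]])
    qed
  qed simp
  moreover have "((\<lambda>e. (c - e) * (norm v)\<^sup>2) \<longlongrightarrow> (c - 0) * (norm v)\<^sup>2) (at_right 0)"
    by (intro tendsto_intros)
  ultimately have "(c - 0) * (norm v)\<^sup>2 \<le> Re (cinner (func_calc f T v) v)"
    by (intro tendsto_upperbound) (auto simp: eventually_at_filter)
  then show ?thesis by simp
qed

lemma func_calc_form_le:
  fixes T :: "'a::complex_hilbert_space \<Rightarrow>\<^sub>L 'a"
  assumes pd: "positive_definite T" and f: "continuous_on {0<..} f"
    and le: "\<And>x. x \<in> real_spectrum T \<Longrightarrow> f x \<le> c"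
  shows "Re (cinner (func_calc f T v) v) \<le> c * (norm v)\<^sup>2"
proof -
  have "func_calc (\<lambda>x. 0 - f x) T = - func_calc f T"
    using func_calc_diff [OF pd continuous_on_const f, of 0] by (simp add: func_calc_const [OF pd])
  moreover have "- c * (norm v)\<^sup>2 \<le> Re (cinner (func_calc (\<lambda>x. 0 - f x) T v) v)"
    by (intro func_calc_form_ge pd continuous_intros f) (use le in auto)
  ultimately show ?thesis by (simp add: cinner_simps)
qed

lemma func_calc_norm_le:
  fixes T :: "'a::complex_hilbert_space \<Rightarrow>\<^sub>L 'a"
  assumes pd: "positive_definite T" and f: "continuous_on {0<..} f" and "0 \<le> c"
    and le: "\<And>x. x \<in> real_spectrum T \<Longrightarrow> \<bar>f x\<bar> \<le> c"
  shows "norm (func_calc f T) \<le> c"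
proof (rule norm_blinfun_bound [OF assms(3)])
  fix v
  have "Re (cinner (func_calc (\<lambda>x. f x * f x) T v) v) \<le> c\<^sup>2 * (norm v)\<^sup>2"
  proof (intro func_calc_form_le pd continuous_intros f)
    show "f x * f x \<le> c\<^sup>2" if "x \<in> real_spectrum T" for x
      using power_mono [OF le [OF that], of 2] by (simp add: power2_eq_square)
  qed
  then have "(norm (func_calc f T v))\<^sup>2 \<le> (c * norm v)\<^sup>2"
    by (simp add: self_adjointD [OF self_adjoint_func_calc [OF pd f]] norm_squared_eq_cinner
        power_mult_distrib flip: func_calc_mult [OF pd f f])
  then show "norm (func_calc f T v) \<le> c * norm v"
    by (rule power2_le_imp_le) (simp add: assms(3))
qed

lemma pd_func_calc:
  fixes T :: "'a::complex_hilbert_space \<Rightarrow>\<^sub>L 'a"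
  assumes pd: "positive_definite T" and f: "continuous_on {0<..} f"
    and pos: "\<And>x. x > 0 \<Longrightarrow> f x > 0"
  shows "positive_definite (func_calc f T)"
proof -
  obtain a b where ab: "0 < a" "real_spectrum T \<subseteq> {a..b}"
    using pd_real_spectrum_bounds [OF pd] by blast
  have "\<exists>c>0. \<forall>x \<in> {a..b}. c \<le> f x"
  proof (cases "{a..b} = {}")
    case True
    then show ?thesis using zero_less_one by blast
  next
    case False
    have "continuous_on {a..b} f" by (rule continuous_on_subset [OF f]) (use ab in auto)
    then obtain x where "x \<in> {a..b}" "\<forall>y \<in> {a..b}. f x \<le> f y"
      using continuous_attains_inf [OF compact_Icc False] by blast
    with pos [of x] ab(1) show ?thesis by auto
  qed
  then obtain c where "c > 0" "\<forall>x \<in> {a..b}. c \<le> f x" by blast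
  with ab(2) show ?thesis
    by (intro coercive_pd [of _ c] func_calc_form_ge self_adjoint_func_calc pd f) auto
qed

text \<open>
  For polynomial \<open>f\<close> the identity follows from additivity and multiplicativity.  In general \<open>f\<close> is
  approximated by polynomials on one interval that contains both the spectrum of \<open>g(T)\<close> and the
  values of \<open>g\<close> on an interval around the spectrum of \<open>T\<close>.
\<close>

lemma func_calc_compose:
  fixes T :: "'a::complex_hilbert_space \<Rightarrow>\<^sub>L 'a"
  assumes pd: "positive_definite T" and f: "continuous_on {0<..} f" and g: "continuous_on {0<..} g"
    and pos: "\<And>x. x > 0 \<Longrightarrow> g x > 0"
  shows "func_calc f (func_calc g T) = func_calc (\<lambda>x. f (g x)) T"
proof -
  let ?G = "func_calc g T"
  have pdG: "positive_definite ?G" by (rule pd_func_calc [OF pd g pos])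
  have fg: "continuous_on {0<..} (\<lambda>x. f (g x))"
    by (rule continuous_on_compose2 [OF f g]) (use pos in auto)
  have pg: "continuous_on {0<..} (\<lambda>x. poly p (g x))" for p
    by (intro continuous_intros g)
  have poly: "poly_op p ?G = func_calc (\<lambda>x. poly p (g x)) T" for p
  proof (induction p)
    case 0
    then show ?case by (simp add: func_calc_const [OF pd])
  next
    case (pCons c p)
    then show ?case
      by (simp add: poly_op_pCons func_calc_add [OF pd] func_calc_const [OF pd] pg g
          continuous_on_mult func_calc_mult [OF pd g pg])
  qed
  obtain a b where ab: "0 < a" "real_spectrum T \<subseteq> {a..b}"
    using pd_real_spectrum_bounds [OF pd] by blast
  obtain c d where cd: "0 < c" "real_spectrum ?G \<subseteq> {c..d}"
    using pd_real_spectrum_bounds [OF pdG] by blast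
  \<comment> \<open>Bounds for the values of \<open>g\<close>, to be merged with the bounds \<open>c\<close> and \<open>d\<close> for the spectrum.\<close>
  obtain c' d' where c': "0 < c'" "g ` {a..b} \<subseteq> {c'..d'}"
  proof (cases "{a..b} = {}")
    case True
    then show thesis using that [of 1 1] by simp
  next
    case False
    have "continuous_on {a..b} g" by (rule continuous_on_subset [OF g]) (use ab in auto)
    then obtain x y where xy: "x \<in> {a..b}" "\<forall>z \<in> {a..b}. g x \<le> g z" "\<forall>z \<in> {a..b}. g z \<le> g y"
      using continuous_attains_inf [OF compact_Icc False] continuous_attains_sup [OF compact_Icc False]
      by metis
    then have "g ` {a..b} \<subseteq> {g x..g y}" by auto
    moreover have "0 < g x" using xy(1) ab(1) by (intro pos) simp
    ultimately show thesis by (intro that)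
  qed
  obtain p where p: "uniform_limit {min c c'..max d d'} (\<lambda>n. poly (p n)) f sequentially"
    using uniform_limit_polynomials [OF f, of "min c c'"] cd c' by auto
  have "(\<lambda>n. poly_op (p n) ?G) \<longlonglongrightarrow> func_calc f ?G"
    by (intro func_calc_limit pdG f uniform_limit_on_subset [OF p]) (use cd in force)
  moreover have "(\<lambda>n. poly_op (p n) ?G) \<longlonglongrightarrow> func_calc (\<lambda>x. f (g x)) T"
  proof (rule metric_LIMSEQ_I)
    fix e :: real
    assume "e > 0"
    then have "e / 2 > 0" by simp
    from uniform_limitD [OF p this]
    have "\<forall>\<^sub>F n in sequentially. dist (poly_op (p n) ?G) (func_calc (\<lambda>x. f (g x)) T) < e"
    proof eventually_elim
      case (elim n)
      have "norm (func_calc (\<lambda>x. poly (p n) (g x) - f (g x)) T) \<le> e / 2"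
      proof (rule func_calc_norm_le [OF pd])
        show "continuous_on {0<..} (\<lambda>x. poly (p n) (g x) - f (g x))"
          by (intro continuous_on_diff pg fg)
        fix x
        assume "x \<in> real_spectrum T"
        then have "g x \<in> {min c c'..max d d'}" using ab(2) c'(2) by force
        with elim show "\<bar>poly (p n) (g x) - f (g x)\<bar> \<le> e / 2" by (force simp: dist_real_def)
      qed (use \<open>e > 0\<close> in simp)
      with \<open>e > 0\<close> show ?case
        by (simp add: poly dist_norm func_calc_diff [OF pd pg fg])
    qed
    then show "\<exists>N. \<forall>n\<ge>N. dist (poly_op (p n) ?G) (func_calc (\<lambda>x. f (g x)) T) < e"
      by (simp add: eventually_sequentially)
  qed
  ultimately show ?thesis by (rule LIMSEQ_unique)
qed

section \<open>Real powers\<close>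

lemma continuous_on_powr_const: "continuous_on {0<..} (\<lambda>x::real. x powr r)"
  by (intro continuous_intros) auto

lemma pd_op_powr:
  fixes T :: "'a::complex_hilbert_space \<Rightarrow>\<^sub>L 'a"
  shows "positive_definite T \<Longrightarrow> positive_definite (T powr\<^sub>o r)"
  unfolding op_powr_def by (rule pd_func_calc) (auto intro: continuous_on_powr_const)

lemma op_powr_compose:
  fixes T :: "'a::complex_hilbert_space \<Rightarrow>\<^sub>L 'a"
  shows "positive_definite T \<Longrightarrow> T powr\<^sub>o r o\<^sub>L T powr\<^sub>o s = T powr\<^sub>o (r + s)"
  unfolding op_powr_def by (simp add: func_calc_mult continuous_on_powr_const powr_add)

lemma op_powr_compose_left:
  fixes T :: "'a::complex_hilbert_space \<Rightarrow>\<^sub>L 'a"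
  shows "positive_definite T \<Longrightarrow> T powr\<^sub>o r o\<^sub>L (T powr\<^sub>o s o\<^sub>L X) = T powr\<^sub>o (r + s) o\<^sub>L X"
  by (simp add: op_powr_compose flip: blinfun_compose_assoc)

lemma op_powr_0:
  fixes T :: "'a::complex_hilbert_space \<Rightarrow>\<^sub>L 'a"
  assumes "positive_definite T"
  shows "T powr\<^sub>o 0 = id_blinfun"
  using func_calc_cong [OF assms, of "\<lambda>x. x powr 0" "\<lambda>x. 1"] func_calc_const [OF assms, of 1]
  by (simp add: op_powr_def)

lemma op_powr_1:
  fixes T :: "'a::complex_hilbert_space \<Rightarrow>\<^sub>L 'a"
  assumes "positive_definite T"
  shows "T powr\<^sub>o 1 = T"
proof -
  have "T powr\<^sub>o 1 = func_calc (poly [:0, 1:]) T"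
    unfolding op_powr_def by (rule func_calc_cong [OF assms]) simp
  then show ?thesis by (simp add: func_calc_poly [OF assms] poly_op_pCons)
qed

lemma op_powr_powr:
  fixes T :: "'a::complex_hilbert_space \<Rightarrow>\<^sub>L 'a"
  shows "positive_definite T \<Longrightarrow> (T powr\<^sub>o r) powr\<^sub>o s = T powr\<^sub>o (r * s)"
  unfolding op_powr_def by (simp add: func_calc_compose continuous_on_powr_const powr_powr)

lemma op_powr_compose_self:
  fixes T :: "'a::complex_hilbert_space \<Rightarrow>\<^sub>L 'a"
  assumes "positive_definite T"
  shows "T powr\<^sub>o r o\<^sub>L T = T powr\<^sub>o (r + 1)" and "T o\<^sub>L T powr\<^sub>o r = T powr\<^sub>o (1 + r)"
    and "T powr\<^sub>o r o\<^sub>L (T o\<^sub>L X) = T powr\<^sub>o (r + 1) o\<^sub>L X"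
    and "T o\<^sub>L (T powr\<^sub>o r o\<^sub>L X) = T powr\<^sub>o (1 + r) o\<^sub>L X"
  using op_powr_compose [OF assms, of r 1] op_powr_compose [OF assms, of 1 r]
    op_powr_compose_left [OF assms, of r 1 X] op_powr_compose_left [OF assms, of 1 r X]
  by (simp_all only: op_powr_1 [OF assms])

lemmas op_powr_simps = blinfun_compose_assoc op_powr_compose op_powr_compose_left op_powr_0
  op_powr_1 op_powr_powr op_powr_compose_self pd_op_powr

lemma op_powr_intertwine:
  fixes S T X :: "'a::complex_hilbert_space \<Rightarrow>\<^sub>L 'a"
  assumes "positive_definite S" and "positive_definite T" and "X o\<^sub>L T = S o\<^sub>L X"
  shows "X o\<^sub>L T powr\<^sub>o r = S powr\<^sub>o r o\<^sub>L X"
  unfolding op_powr_def using assms by (intro func_calc_intertwine continuous_on_powr_const)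

lemma op_powr_minus_1_eqI:
  fixes T :: "'a::complex_hilbert_space \<Rightarrow>\<^sub>L 'a"
  assumes "positive_definite T" and "T o\<^sub>L S = id_blinfun"
  shows "T powr\<^sub>o (- 1) = S"
proof -
  have "T powr\<^sub>o (- 1) = T powr\<^sub>o (- 1) o\<^sub>L (T powr\<^sub>o 1 o\<^sub>L S)"
    by (simp add: assms op_powr_1)
  also have "\<dots> = S"
    by (simp only: op_powr_compose_left [OF assms(1)]) (simp add: op_powr_0 assms(1))
  finally show ?thesis .
qed

lemma is_op_inverse_op_powr:
  fixes T :: "'a::complex_hilbert_space \<Rightarrow>\<^sub>L 'a"
  assumes "positive_definite T"
  shows "is_op_inverse (T powr\<^sub>o r) (T powr\<^sub>o (- r))"
  using assms by (simp add: is_op_inverse_def op_powr_compose op_powr_0 self_adjoint_clinear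
      pd_self_adjoint pd_op_powr)

lemma op_inverse_pd:
  fixes T :: "'a::complex_hilbert_space \<Rightarrow>\<^sub>L 'a"
  assumes "positive_definite T"
  shows "op_inverse T = T powr\<^sub>o (- 1)"
  using is_op_inverse_op_powr [OF assms, of 1] by (intro op_inverse_eqI) (simp add: op_powr_1 assms)

lemma invertible_op_powr:
  fixes T :: "'a::complex_hilbert_space \<Rightarrow>\<^sub>L 'a"
  assumes "positive_definite T"
  shows "invertible_op (T powr\<^sub>o r)"
  by (intro pd_invertible pd_op_powr assms)

text \<open>
  The function \<open>x powr r\<close> of both variables is uniformly continuous on a compact rectangle around the
  spectrum and the limit exponent.
\<close>

lemma op_powr_tendsto:
  fixes T :: "'a::complex_hilbert_space \<Rightarrow>\<^sub>L 'a"
  assumes pd: "positive_definite T" and r: "r \<longlonglongrightarrow> s"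
  shows "(\<lambda>n. T powr\<^sub>o r n) \<longlonglongrightarrow> T powr\<^sub>o s"
proof (rule metric_LIMSEQ_I)
  fix e :: real
  assume "e > 0"
  then have "e / 2 > 0" by simp
  obtain a b where ab: "0 < a" "real_spectrum T \<subseteq> {a..b}"
    using pd_real_spectrum_bounds [OF pd] by blast
  let ?h = "\<lambda>z :: real \<times> real. snd z powr fst z"
  let ?K = "{s - 1..s + 1} \<times> {a..b}"
  have "continuous_on ?K ?h" by (intro continuous_intros) (use ab(1) in auto)
  then have "uniformly_continuous_on ?K ?h"
    by (intro compact_uniformly_continuous compact_Times compact_Icc)
  then obtain d where d: "d > 0"
    "\<And>y z. y \<in> ?K \<Longrightarrow> z \<in> ?K \<Longrightarrow> dist z y < d \<Longrightarrow> dist (?h z) (?h y) < e / 2"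
    unfolding uniformly_continuous_on_def using \<open>e / 2 > 0\<close> by metis
  have "min d 1 > 0" using d(1) by simp
  with r have "\<forall>\<^sub>F n in sequentially. dist (r n) s < min d 1" by (rule tendstoD)
  then have "\<forall>\<^sub>F n in sequentially. dist (T powr\<^sub>o r n) (T powr\<^sub>o s) < e"
  proof eventually_elim
    case (elim n)
    have "norm (func_calc (\<lambda>x. x powr r n - x powr s) T) \<le> e / 2"
    proof (rule func_calc_norm_le [OF pd])
      show "continuous_on {0<..} (\<lambda>x. x powr r n - x powr s)"
        by (intro continuous_on_diff continuous_on_powr_const)
      fix x
      assume "x \<in> real_spectrum T"
      with ab(2) elim have "(s, x) \<in> ?K" "(r n, x) \<in> ?K" by (auto simp: dist_real_def)
      moreover have "dist (r n, x) (s, x) < d" using elim by (simp add: dist_Pair_Pair)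
      ultimately have "dist (?h (r n, x)) (?h (s, x)) < e / 2" by (rule d(2))
      then show "\<bar>x powr r n - x powr s\<bar> \<le> e / 2" by (simp add: dist_real_def)
    qed (use \<open>e > 0\<close> in simp)
    with \<open>e > 0\<close> show ?case
      by (simp add: op_powr_def dist_norm func_calc_diff [OF pd] continuous_on_powr_const)
  qed
  then show "\<exists>N. \<forall>n\<ge>N. dist (T powr\<^sub>o r n) (T powr\<^sub>o s) < e"
    by (simp add: eventually_sequentially)
qed

section \<open>The Loewner order\<close>

lemma loewner_le_iff_form:
  "X \<preceq> Y \<longleftrightarrow> self_adjoint X \<and> self_adjoint Y
    \<and> (\<forall>v. Re (cinner (X v) v) \<le> Re (cinner (Y v) v))"
  by (auto simp: loewner_le_def positive_semidefinite_def cinner_simps self_adjoint_diff)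

lemma loewner_le_trans: "X \<preceq> Y \<Longrightarrow> Y \<preceq> Z \<Longrightarrow> X \<preceq> Z"
  unfolding loewner_le_iff_form by (blast intro: order_trans)

lemma self_adjoint_conj:
  "self_adjoint Z \<Longrightarrow> self_adjoint K \<Longrightarrow> self_adjoint (Z o\<^sub>L (K o\<^sub>L Z))"
  by (simp add: self_adjoint_iff_adjoint_pair adjoint_pair_def)

lemma loewner_le_conj:
  assumes "X \<preceq> Y" and "self_adjoint Z"
  shows "Z o\<^sub>L (X o\<^sub>L Z) \<preceq> Z o\<^sub>L (Y o\<^sub>L Z)"
  using assms by (auto simp: loewner_le_iff_form self_adjoint_conj self_adjointD [OF assms(2)])

lemma pd_conj:
  assumes "positive_definite K" and "adjoint_pair X Y" and "invertible_op X" and "invertible_op Y"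
  shows "positive_definite (Y o\<^sub>L (K o\<^sub>L X))"
proof -
  have "cinner (Y (K (X v))) v = cinner (K (X v)) (X v)" for v
    by (rule adjoint_pairD [OF adjoint_pair_sym [OF assms(2)]])
  then have "0 \<le> Re (cinner ((Y o\<^sub>L (K o\<^sub>L X)) v) v)" for v
    using psd_form_nonneg [OF pd_psd [OF assms(1)], of "X v"] by simp
  moreover have "adjoint_pair (Y o\<^sub>L (K o\<^sub>L X)) (Y o\<^sub>L (K o\<^sub>L X))"
    using adjoint_pair_compose [OF adjoint_pair_sym [OF assms(2)]
        adjoint_pair_compose [OF _ assms(2)], of K K] pd_self_adjoint [OF assms(1)]
    by (simp add: self_adjoint_iff_adjoint_pair blinfun_compose_assoc)
  moreover have "invertible_op (Y o\<^sub>L (K o\<^sub>L X))"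
    by (intro invertible_op_compose assms pd_invertible)
  ultimately show ?thesis
    by (simp add: positive_definite_def positive_semidefinite_def self_adjoint_iff_adjoint_pair)
qed

lemma adjoint_pair_op_powr:
  fixes T :: "'a::complex_hilbert_space \<Rightarrow>\<^sub>L 'a"
  assumes "positive_definite T"
  shows "adjoint_pair (T powr\<^sub>o r) (T powr\<^sub>o r)"
  using pd_self_adjoint [OF pd_op_powr [OF assms]] by (simp add: self_adjoint_iff_adjoint_pair)

lemma pd_conj_op_powr:
  fixes K T :: "'a::complex_hilbert_space \<Rightarrow>\<^sub>L 'a"
  assumes "positive_definite K" and "positive_definite T"
  shows "positive_definite (T powr\<^sub>o r o\<^sub>L (K o\<^sub>L T powr\<^sub>o r))"
  using assms by (intro pd_conj adjoint_pair_op_powr invertible_op_powr)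

lemma loewner_le_conj_op_powr:
  fixes T :: "'a::complex_hilbert_space \<Rightarrow>\<^sub>L 'a"
  assumes "X \<preceq> Y" and "positive_definite T"
  shows "T powr\<^sub>o r o\<^sub>L (X o\<^sub>L T powr\<^sub>o r) \<preceq> T powr\<^sub>o r o\<^sub>L (Y o\<^sub>L T powr\<^sub>o r)"
  by (intro loewner_le_conj assms pd_self_adjoint pd_op_powr)

text \<open>
  Conjugation of the hypothesis by \<open>K powr\<^sub>o (- 1/2)\<close>.
\<close>

lemma id_le_inverse:
  fixes K :: "'a::complex_hilbert_space \<Rightarrow>\<^sub>L 'a"
  assumes "positive_definite K" and "K \<preceq> id_blinfun"
  shows "id_blinfun \<preceq> K powr\<^sub>o (- 1)"
proof -
  have "K powr\<^sub>o (- 1/2) o\<^sub>L (K powr\<^sub>o 1 o\<^sub>L K powr\<^sub>o (- 1/2))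
      \<preceq> K powr\<^sub>o (- 1/2) o\<^sub>L (id_blinfun o\<^sub>L K powr\<^sub>o (- 1/2))"
    using assms by (intro loewner_le_conj_op_powr) (simp_all add: op_powr_1)
  then show ?thesis
    by (simp add: op_powr_compose op_powr_0 assms(1))
qed

text \<open>
  The form of \<open>Z o\<^sub>L X\<close> at \<open>w\<close> is the square of \<open>norm (X w)\<close>; put \<open>w = (Q powr\<^sub>o (- 1/2)) v\<close>.
\<close>

lemma contraction_of_loewner_le:
  fixes X Z Q :: "'a::complex_hilbert_space \<Rightarrow>\<^sub>L 'a"
  assumes "adjoint_pair X Z" and "Z o\<^sub>L X \<preceq> Q" and "positive_definite Q"
  shows "norm ((X o\<^sub>L Q powr\<^sub>o (- 1/2)) v) \<le> norm v"
proof -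
  let ?R = "Q powr\<^sub>o (- 1/2)"
  have R: "?R o\<^sub>L (Q powr\<^sub>o 1 o\<^sub>L ?R) = id_blinfun"
    by (simp only: op_powr_compose [OF assms(3)]) (simp add: op_powr_0 assms(3))
  have "(norm (X (?R v)))\<^sup>2 = Re (cinner (Z (X (?R v))) (?R v))"
    by (simp add: norm_squared_eq_cinner adjoint_pairD [OF adjoint_pair_sym [OF assms(1)]])
  also have "\<dots> \<le> Re (cinner (Q (?R v)) (?R v))"
    using assms(2) by (simp add: loewner_le_iff_form)
  also have "\<dots> = Re (cinner ((?R o\<^sub>L (Q powr\<^sub>o 1 o\<^sub>L ?R)) v) v)"
    using adjoint_pair_op_powr [OF assms(3), of "- 1/2"]
    by (simp add: adjoint_pairD op_powr_1 assms(3))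
  also have "\<dots> = (norm v)\<^sup>2" unfolding R by (simp add: norm_squared_eq_cinner)
  finally have "norm (X (?R v)) \<le> norm v" by (rule power2_le_imp_le) simp
  then show ?thesis by simp
qed

lemma adjoint_contraction:
  assumes "adjoint_pair X Z" and "\<And>v. norm (X v) \<le> norm v"
  shows "norm (Z v) \<le> norm v"
proof (cases "Z v = 0")
  case False
  have "norm (Z v) * norm (Z v) = Re (cinner (X (Z v)) v)"
    by (simp add: adjoint_pairD [OF assms(1)] norm_squared_eq_cinner flip: power2_eq_square)
  also have "\<dots> \<le> norm (X (Z v)) * norm v" using Re_cinner_le_norm [of "X (Z v)" v] by simp
  also have "\<dots> \<le> norm (Z v) * norm v" by (intro mult_right_mono assms(2)) simp
  finally show ?thesis using False by simp
qed simp

text \<open>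
  The definition of \<open>is_op_inverse\<close> states complex linearity for the second operator; the first
  operator inherits it.
\<close>

lemma is_op_inverse_sym:
  assumes "is_op_inverse S V"
  shows "is_op_inverse V S"
proof -
  have SV: "S (V x) = x" and VS: "V (S x) = x" for x
    using assms unfolding is_op_inverse_def
    by (metis blinfun_apply_blinfun_compose blinfun_apply_id_blinfun)+
  have "S (c *\<^sub>C x) = c *\<^sub>C S x" for c x
  proof -
    have "V (c *\<^sub>C S x) = c *\<^sub>C x"
      using assms by (simp add: is_op_inverse_def clinear_op_def VS)
    then show ?thesis using SV [of "c *\<^sub>C S x"] by simp
  qed
  with assms show ?thesis by (simp add: is_op_inverse_def clinear_op_def)
qed

text \<open>
  Similar operators have the same spectrum, and \<open>x - Y\<close> is coercive for \<open>x > 1\<close>.  For self-adjoint \<open>K\<close>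
  the resulting bound on the spectrum is a bound in the Loewner order.
\<close>

lemma self_adjoint_similar_to_contraction_le_id:
  fixes K S Y :: "'a::complex_hilbert_space \<Rightarrow>\<^sub>L 'a"
  assumes "self_adjoint K" and "invertible_op S" and "clinear_op Y"
    and SK: "S o\<^sub>L K = Y o\<^sub>L S" and contr: "\<And>v. norm (Y v) \<le> norm v"
  shows "K \<preceq> id_blinfun"
proof -
  obtain V where V: "is_op_inverse S V" using assms(2) by (auto simp: invertible_op_def)
  have "x \<le> 1" if "x \<in> real_spectrum K" for x
  proof (rule ccontr)
    assume "\<not> x \<le> 1"
    let ?R = "x *\<^sub>R id_blinfun - Y"
    have clR: "clinear_op ?R"
      unfolding scalar_op_of_real [symmetric] by (intro clinear_op_diff clinear_op_scalar assms(3))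
    have "(x - 1) * (norm v)\<^sup>2 \<le> Re (cinner (?R v) v)" for v
    proof -
      have "Re (cinner (Y v) v) \<le> norm (Y v) * norm v" using Re_cinner_le_norm [of "Y v" v] by simp
      also have "\<dots> \<le> norm v * norm v" by (intro mult_right_mono contr) simp
      finally have "Re (cinner (Y v) v) \<le> Re (cinner v v)"
        by (simp add: power2_eq_square flip: norm_squared_eq_cinner)
      then show ?thesis by (simp add: cinner_simps norm_squared_eq_cinner algebra_simps)
    qed
    with clR \<open>\<not> x \<le> 1\<close> have "invertible_op ?R" by (intro coercive_invertible [of ?R "x - 1"]) auto
    then have "invertible_op (V o\<^sub>L (?R o\<^sub>L S))"
      using is_op_inverse_sym [OF V] assms(2)
      by (intro invertible_op_compose) (auto simp: invertible_op_def)
    moreover have "V o\<^sub>L (?R o\<^sub>L S) = x *\<^sub>R id_blinfun - K"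
    proof -
      have "V o\<^sub>L (?R o\<^sub>L S) = V o\<^sub>L (S o\<^sub>L (x *\<^sub>R id_blinfun - K))"
        by (simp add: compose_bilinear_simps SK)
      then show ?thesis using V by (simp add: is_op_inverse_def flip: blinfun_compose_assoc)
    qed
    ultimately obtain W where "is_op_inverse (x *\<^sub>R id_blinfun - K) W"
      by (auto simp: invertible_op_def)
    then have "is_op_inverse (- (x *\<^sub>R id_blinfun - K)) (- W)"
      by (simp add: is_op_inverse_def clinear_op_def scaleC_minus_right uminus_blinfun.rep_eq
          compose_bilinear_simps(7,8) del: minus_diff_eq)
    then have "is_op_inverse (K - x *\<^sub>R id_blinfun) (- W)" by simp
    with that show False by (auto simp: real_spectrum_iff invertible_op_def)
  qed
  then have "- 1 * (norm v)\<^sup>2 \<le> Re (cinner (poly_op [:0, - 1:] K v) v)" for v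
    by (intro poly_op_form_ge assms(1)) auto
  moreover have "poly_op [:0, - 1:] K = - K"
    by (simp add: poly_op_pCons compose_bilinear_simps)
  ultimately show ?thesis
    by (simp add: loewner_le_iff_form assms(1) self_adjoint_id cinner_simps norm_squared_eq_cinner)
qed

section \<open>The Loewner-Heinz inequality\<close>

text \<open>
  Pedersen's argument.  With \<open>u = (s + t) / 2\<close>, the operator
  \<open>K = B powr\<^sub>o (- u/2) o\<^sub>L A powr\<^sub>o u o\<^sub>L B powr\<^sub>o (- u/2)\<close> is similar to
  \<open>(B powr\<^sub>o (- s/2) o\<^sub>L A powr\<^sub>o (s/2)) o\<^sub>L (A powr\<^sub>o (t/2) o\<^sub>L B powr\<^sub>o (- t/2))\<close>, a product of two contractions by
  the hypotheses, so that \<open>K \<preceq> id_blinfun\<close>.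
\<close>

lemma loewner_heinz_midpoint:
  fixes A B :: "'a::complex_hilbert_space \<Rightarrow>\<^sub>L 'a"
  assumes A: "positive_definite A" and B: "positive_definite B"
    and s: "A powr\<^sub>o s \<preceq> B powr\<^sub>o s" and t: "A powr\<^sub>o t \<preceq> B powr\<^sub>o t"
  shows "A powr\<^sub>o ((s + t) / 2) \<preceq> B powr\<^sub>o ((s + t) / 2)"
proof -
  define u where "u = (s + t) / 2"
  have contr: "norm ((A powr\<^sub>o (r/2) o\<^sub>L B powr\<^sub>o (- r/2)) v) \<le> norm v"
    if "A powr\<^sub>o r \<preceq> B powr\<^sub>o r" for r v
  proof -
    have "A powr\<^sub>o (r/2) o\<^sub>L A powr\<^sub>o (r/2) \<preceq> B powr\<^sub>o r"
      using that by (simp add: op_powr_compose A)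
    then have "norm ((A powr\<^sub>o (r/2) o\<^sub>L (B powr\<^sub>o r) powr\<^sub>o (- 1/2)) v) \<le> norm v"
      by (rule contraction_of_loewner_le [OF adjoint_pair_op_powr [OF A] _ pd_op_powr [OF B]])
    then show ?thesis by (simp add: op_powr_powr B)
  qed
  have contr': "norm ((B powr\<^sub>o (- s/2) o\<^sub>L A powr\<^sub>o (s/2)) v) \<le> norm v" for v
    by (rule adjoint_contraction [OF adjoint_pair_compose contr [OF s]])
      (intro adjoint_pair_op_powr A B)+
  define K where "K = B powr\<^sub>o (- u/2) o\<^sub>L (A powr\<^sub>o u o\<^sub>L B powr\<^sub>o (- u/2))"
  define Y where "Y = (B powr\<^sub>o (- s/2) o\<^sub>L A powr\<^sub>o (s/2)) o\<^sub>L (A powr\<^sub>o (t/2) o\<^sub>L B powr\<^sub>o (- t/2))"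
  have "K \<preceq> id_blinfun"
  proof (rule self_adjoint_similar_to_contraction_le_id)
    show "self_adjoint K" unfolding K_def by (intro pd_self_adjoint pd_conj_op_powr pd_op_powr A B)
    \<comment> \<open>The exponent \<open>(u - s)/2\<close> is chosen to match the left factors of \<open>K\<close> and \<open>Y\<close>; the right factors then
      match because \<open>u\<close> is the midpoint.\<close>
    show "invertible_op (B powr\<^sub>o ((u - s)/2))" by (rule invertible_op_powr [OF B])
    show "clinear_op Y" unfolding Y_def
      by (intro clinear_op_compose self_adjoint_clinear pd_self_adjoint pd_op_powr A B)
    have "(u - s)/2 + - u/2 = - s/2" "s/2 + t/2 = u" "- t/2 + (u - s)/2 = - u/2"
      by (simp_all add: u_def field_simps)
    then show "B powr\<^sub>o ((u - s)/2) o\<^sub>L K = Y o\<^sub>L B powr\<^sub>o ((u - s)/2)"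
      by (simp only: K_def Y_def blinfun_compose_assoc op_powr_compose_left [OF A]
          op_powr_compose_left [OF B] op_powr_compose [OF B])
    show "norm (Y v) \<le> norm v" for v
      using order_trans [OF contr' contr [OF t]] by (simp add: Y_def)
  qed
  then have "B powr\<^sub>o (u/2) o\<^sub>L (K o\<^sub>L B powr\<^sub>o (u/2))
      \<preceq> B powr\<^sub>o (u/2) o\<^sub>L (id_blinfun o\<^sub>L B powr\<^sub>o (u/2))"
    by (rule loewner_le_conj_op_powr) (rule B)
  then have "A powr\<^sub>o u \<preceq> B powr\<^sub>o u" by (simp add: K_def op_powr_simps A B)
  then show ?thesis by (simp add: u_def)
qed

text \<open>
  A point of the interval outside \<open>D\<close> would lie in a gap of \<open>D\<close> whose end points belong to \<open>D\<close>, but the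
  midpoint of the gap belongs to \<open>D\<close> as well.
\<close>

lemma closed_midpoint_set_contains_interval:
  fixes D :: "real set"
  assumes "closed D" and "a \<in> D" and "b \<in> D"
    and mid: "\<And>x y. x \<in> D \<Longrightarrow> y \<in> D \<Longrightarrow> (x + y) / 2 \<in> D"
  shows "{a..b} \<subseteq> D"
proof
  fix t
  assume t: "t \<in> {a..b}"
  show "t \<in> D"
  proof (rule ccontr)
    assume "t \<notin> D"
    define l where "l = Sup (D \<inter> {..t})"
    define u where "u = Inf (D \<inter> {t..})"
    have "l \<in> D \<inter> {..t}"
      unfolding l_def by (rule closed_contains_Sup) (use assms t in auto)
    have "u \<in> D \<inter> {t..}"
      unfolding u_def by (rule closed_contains_Inf) (use assms t in auto)
    have l: "x \<le> l" if "x \<in> D" "x \<le> t" for x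
      unfolding l_def by (rule cSup_upper) (use that in auto)
    have u: "u \<le> x" if "x \<in> D" "t \<le> x" for x
      unfolding u_def by (rule cInf_lower) (use that in auto)
    have "(l + u) / 2 \<in> D" using mid \<open>l \<in> _\<close> \<open>u \<in> _\<close> by blast
    with l [of "(l + u) / 2"] u [of "(l + u) / 2"] have "u \<le> l" by argo
    with \<open>l \<in> _\<close> \<open>u \<in> _\<close> have "l = t" by auto
    with \<open>l \<in> _\<close> \<open>t \<notin> D\<close> show False by simp
  qed
qed

text \<open>
  The admissible exponents form a set that is closed, by continuity of powers in the exponent, and
  closed under midpoints, and it contains \<open>0\<close> and \<open>1\<close>.
\<close>

theorem loewner_heinz:
  fixes A B :: "'a::complex_hilbert_space \<Rightarrow>\<^sub>L 'a"
  assumes A: "positive_definite A" and B: "positive_definite B" and AB: "A \<preceq> B"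
    and "0 \<le> t" and "t \<le> 1"
  shows "A powr\<^sub>o t \<preceq> B powr\<^sub>o t"
proof -
  define D where "D = {t. A powr\<^sub>o t \<preceq> B powr\<^sub>o t}"
  note sa = pd_self_adjoint [OF pd_op_powr]
  have "closed D"
    unfolding closed_sequential_limits
  proof (intro allI impI, elim conjE)
    fix r s
    assume r: "\<forall>n. r n \<in> D" "r \<longlonglongrightarrow> s"
    have lim: "(\<lambda>n. Re (cinner ((T powr\<^sub>o r n) v) v)) \<longlonglongrightarrow> Re (cinner ((T powr\<^sub>o s) v) v)"
      if "positive_definite T" for T :: "'a \<Rightarrow>\<^sub>L 'a" and v
      by (intro tendsto_Re cinner.tendsto blinfun.tendsto tendsto_const op_powr_tendsto that r)
    have "Re (cinner ((A powr\<^sub>o s) v) v) \<le> Re (cinner ((B powr\<^sub>o s) v) v)" for v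
      by (rule LIMSEQ_le [OF lim [OF A] lim [OF B]]) (use r(1) in \<open>auto simp: D_def loewner_le_iff_form\<close>)
    then show "s \<in> D" by (simp add: D_def loewner_le_iff_form sa A B)
  qed
  moreover have "0 \<in> D" "1 \<in> D"
    using AB by (auto simp: D_def op_powr_0 op_powr_1 A B loewner_le_iff_form self_adjoint_id)
  moreover have "(x + y) / 2 \<in> D" if "x \<in> D" "y \<in> D" for x y
    using that loewner_heinz_midpoint [OF A B] by (simp add: D_def)
  ultimately have "{0..1} \<subseteq> D" by (rule closed_midpoint_set_contains_interval)
  with assms(4,5) show ?thesis by (auto simp: D_def)
qed

section \<open>Geometric means\<close>

lemma geometric_mean_eq:
  "geometric_mean t P Q = P powr\<^sub>o (1/2) o\<^sub>L
    ((P powr\<^sub>o (-1/2) o\<^sub>L (Q o\<^sub>L P powr\<^sub>o (-1/2))) powr\<^sub>o t o\<^sub>L P powr\<^sub>o (1/2))"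
  by (simp only: geometric_mean_def blinfun_compose_assoc)

lemma pd_geometric_mean:
  fixes P Q :: "'a::complex_hilbert_space \<Rightarrow>\<^sub>L 'a"
  assumes "positive_definite P" and "positive_definite Q"
  shows "positive_definite (geometric_mean t P Q)"
  unfolding geometric_mean_eq by (intro pd_conj_op_powr pd_op_powr assms)

lemma geometric_mean_op_powr:
  fixes C :: "'a::complex_hilbert_space \<Rightarrow>\<^sub>L 'a"
  assumes "positive_definite C"
  shows "geometric_mean t (C powr\<^sub>o r) (C powr\<^sub>o s) = C powr\<^sub>o ((1 - t) * r + t * s)"
proof -
  have "geometric_mean t (C powr\<^sub>o r) (C powr\<^sub>o s)
      = C powr\<^sub>o (r * (1/2) + ((r * (-1/2) + (s + r * (-1/2))) * t + r * (1/2)))"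
    by (simp only: geometric_mean_eq op_powr_powr [OF assms] op_powr_compose [OF assms])
  also have "r * (1/2) + ((r * (-1/2) + (s + r * (-1/2))) * t + r * (1/2)) = (1 - t) * r + t * s"
    by (simp add: field_simps)
  finally show ?thesis .
qed

text \<open>
  The square root of \<open>R\<close> in the definition of the mean may be replaced by any factor \<open>L\<close> with
  \<open>L o\<^sub>L L' = R\<close>: the operator \<open>U = M o\<^sub>L R powr\<^sub>o (1/2)\<close>, which is unitary, intertwines the two middle factors and
  therefore also their powers.
\<close>

lemma geometric_mean_factor:
  fixes R Q L L' M M' :: "'a::complex_hilbert_space \<Rightarrow>\<^sub>L 'a"
  assumes R: "positive_definite R" and Q: "positive_definite Q"
    and adj: "adjoint_pair L L'" and R_eq: "L o\<^sub>L L' = R"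
    and M: "is_op_inverse L M" and M': "is_op_inverse L' M'"
  shows "geometric_mean t R Q = L o\<^sub>L ((M o\<^sub>L (Q o\<^sub>L M')) powr\<^sub>o t o\<^sub>L L')"
proof -
  have inv: "L o\<^sub>L (M o\<^sub>L X) = X" "M o\<^sub>L (L o\<^sub>L X) = X" "L' o\<^sub>L (M' o\<^sub>L X) = X" "M' o\<^sub>L (L' o\<^sub>L X) = X"
    for X :: "'a \<Rightarrow>\<^sub>L 'a"
    using M M' by (simp_all add: is_op_inverse_def flip: blinfun_compose_assoc)
  have adjM: "adjoint_pair M' M"
  proof -
    have "cinner (M' x) y = cinner x (M y)" for x y
    proof -
      have "L (M y) = y" "L' (M' x) = x"
        using M M' unfolding is_op_inverse_def
        by (metis blinfun_apply_blinfun_compose blinfun_apply_id_blinfun)+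
      then show ?thesis
        by (metis adjoint_pairD [OF adjoint_pair_sym [OF adj]])
    qed
    then show ?thesis by (simp add: adjoint_pair_def)
  qed
  define U where "U = M o\<^sub>L R powr\<^sub>o (1/2)"
  define N where "N = R powr\<^sub>o (-1/2) o\<^sub>L (Q o\<^sub>L R powr\<^sub>o (-1/2))"
  define N' where "N' = M o\<^sub>L (Q o\<^sub>L M')"
  have pdN: "positive_definite N" unfolding N_def by (intro pd_conj_op_powr R Q)
  have pdN': "positive_definite N'"
    unfolding N'_def using M M'
    by (intro pd_conj Q adjM)
      (auto simp: invertible_op_def is_op_inverse_def intro: adjoint_pair_clinear [OF adj]
        adjoint_pair_clinear [OF adjoint_pair_sym [OF adj]])
  have R_inv: "M' o\<^sub>L M = R powr\<^sub>o (- 1)"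
    by (rule op_powr_minus_1_eqI [OF R, symmetric])
      (use M inv(3) in \<open>simp add: R_eq [symmetric] blinfun_compose_assoc is_op_inverse_def\<close>)
  have MR: "M o\<^sub>L R = L'" by (simp add: R_eq [symmetric] inv)
  have "U o\<^sub>L N = M o\<^sub>L (Q o\<^sub>L R powr\<^sub>o (-1/2))"
    by (simp add: U_def N_def op_powr_simps R)
  also have "R powr\<^sub>o (-1/2) = R powr\<^sub>o (- 1) o\<^sub>L R powr\<^sub>o (1/2)"
    by (simp add: op_powr_compose R)
  also have "M o\<^sub>L (Q o\<^sub>L (R powr\<^sub>o (- 1) o\<^sub>L R powr\<^sub>o (1/2))) = N' o\<^sub>L U"
    by (simp add: U_def N'_def blinfun_compose_assoc flip: R_inv)
  finally have UN: "U o\<^sub>L N powr\<^sub>o t = N' powr\<^sub>o t o\<^sub>L U"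
    by (rule op_powr_intertwine [OF pdN' pdN])
  have "geometric_mean t R Q = (L o\<^sub>L U) o\<^sub>L (N powr\<^sub>o t o\<^sub>L R powr\<^sub>o (1/2))"
    by (simp add: geometric_mean_eq N_def U_def inv)
  also have "\<dots> = L o\<^sub>L ((U o\<^sub>L N powr\<^sub>o t) o\<^sub>L R powr\<^sub>o (1/2))"
    by (simp only: blinfun_compose_assoc)
  also have "\<dots> = L o\<^sub>L (N' powr\<^sub>o t o\<^sub>L (M o\<^sub>L R powr\<^sub>o 1))"
    unfolding UN by (simp add: U_def op_powr_simps R)
  finally show ?thesis by (simp add: N'_def op_powr_1 R MR)
qed

text \<open>
  The mean of the conjugated operators is computed with the factor \<open>Z powr\<^sub>o r o\<^sub>L P powr\<^sub>o (1/2)\<close> in place of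
  the square root.
\<close>

lemma geometric_mean_conj:
  fixes P Q Z :: "'a::complex_hilbert_space \<Rightarrow>\<^sub>L 'a"
  assumes P: "positive_definite P" and Q: "positive_definite Q" and Z: "positive_definite Z"
  shows "geometric_mean t (Z powr\<^sub>o r o\<^sub>L (P o\<^sub>L Z powr\<^sub>o r)) (Z powr\<^sub>o r o\<^sub>L (Q o\<^sub>L Z powr\<^sub>o r))
    = Z powr\<^sub>o r o\<^sub>L (geometric_mean t P Q o\<^sub>L Z powr\<^sub>o r)"
proof -
  have "geometric_mean t (Z powr\<^sub>o r o\<^sub>L (P o\<^sub>L Z powr\<^sub>o r)) (Z powr\<^sub>o r o\<^sub>L (Q o\<^sub>L Z powr\<^sub>o r))
    = (Z powr\<^sub>o r o\<^sub>L P powr\<^sub>o (1/2)) o\<^sub>L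
      (((P powr\<^sub>o (- (1/2)) o\<^sub>L Z powr\<^sub>o (- r)) o\<^sub>L ((Z powr\<^sub>o r o\<^sub>L (Q o\<^sub>L Z powr\<^sub>o r))
        o\<^sub>L (Z powr\<^sub>o (- r) o\<^sub>L P powr\<^sub>o (- (1/2))))) powr\<^sub>o t o\<^sub>L (P powr\<^sub>o (1/2) o\<^sub>L Z powr\<^sub>o r))"
  proof (rule geometric_mean_factor)
    have "P powr\<^sub>o (1/2) o\<^sub>L P powr\<^sub>o (1/2) = P" by (simp add: op_powr_simps P)
    then show "(Z powr\<^sub>o r o\<^sub>L P powr\<^sub>o (1/2)) o\<^sub>L (P powr\<^sub>o (1/2) o\<^sub>L Z powr\<^sub>o r)
        = Z powr\<^sub>o r o\<^sub>L (P o\<^sub>L Z powr\<^sub>o r)"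
      by (metis blinfun_compose_assoc)
  qed (intro pd_conj_op_powr adjoint_pair_compose adjoint_pair_op_powr is_op_inverse_compose
      is_op_inverse_op_powr P Q Z)+
  also have "(P powr\<^sub>o (- (1/2)) o\<^sub>L Z powr\<^sub>o (- r)) o\<^sub>L ((Z powr\<^sub>o r o\<^sub>L (Q o\<^sub>L Z powr\<^sub>o r))
        o\<^sub>L (Z powr\<^sub>o (- r) o\<^sub>L P powr\<^sub>o (- (1/2))))
      = P powr\<^sub>o (-1/2) o\<^sub>L (Q o\<^sub>L P powr\<^sub>o (-1/2))"
    by (simp add: op_powr_simps Z)
  finally show ?thesis by (simp only: geometric_mean_eq blinfun_compose_assoc)
qed

text \<open>
  With \<open>Y = Q powr\<^sub>o (1/2) o\<^sub>L P powr\<^sub>o (-1/2)\<close>, the operator inside the left mean is \<open>Y* Y\<close> and the one inside the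
  right mean is the inverse of \<open>Y Y*\<close>; \<open>Y\<close> intertwines their powers.
\<close>

lemma geometric_mean_commute:
  fixes P Q :: "'a::complex_hilbert_space \<Rightarrow>\<^sub>L 'a"
  assumes P: "positive_definite P" and Q: "positive_definite Q"
  shows "geometric_mean t P Q = geometric_mean (1 - t) Q P"
proof -
  define Y where "Y = Q powr\<^sub>o (1/2) o\<^sub>L P powr\<^sub>o (-1/2)"
  define N where "N = P powr\<^sub>o (-1/2) o\<^sub>L (Q o\<^sub>L P powr\<^sub>o (-1/2))"
  define N' where "N' = Q powr\<^sub>o (1/2) o\<^sub>L (P powr\<^sub>o (- 1) o\<^sub>L Q powr\<^sub>o (1/2))"
  have pdN: "positive_definite N" and pdN': "positive_definite N'"
    unfolding N_def N'_def by (intro pd_conj_op_powr pd_op_powr P Q)+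
  have "Y o\<^sub>L N = Q powr\<^sub>o (1/2) o\<^sub>L (P powr\<^sub>o (- 1) o\<^sub>L (Q powr\<^sub>o 1 o\<^sub>L P powr\<^sub>o (-1/2)))"
    by (simp add: Y_def N_def op_powr_simps P Q)
  also have "\<dots> = N' o\<^sub>L Y"
    by (simp add: Y_def N'_def op_powr_simps P Q)
  finally have YN: "Y o\<^sub>L N powr\<^sub>o (t - 1) = N' powr\<^sub>o (t - 1) o\<^sub>L Y"
    by (rule op_powr_intertwine [OF pdN' pdN])
  have inv: "Q powr\<^sub>o (-1/2) o\<^sub>L (P o\<^sub>L Q powr\<^sub>o (-1/2)) = N' powr\<^sub>o (- 1)"
    by (rule op_powr_minus_1_eqI [OF pdN', symmetric]) (simp add: N'_def op_powr_simps P Q)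
  have "geometric_mean (1 - t) Q P = Q powr\<^sub>o (1/2) o\<^sub>L (N' powr\<^sub>o (t - 1) o\<^sub>L Q powr\<^sub>o (1/2))"
    by (simp only: geometric_mean_eq inv op_powr_powr [OF pdN']) simp
  also have "Q powr\<^sub>o (1/2) = Y o\<^sub>L P powr\<^sub>o (1/2)"
    by (simp add: Y_def op_powr_simps P)
  finally have "geometric_mean (1 - t) Q P
      = Q powr\<^sub>o (1/2) o\<^sub>L ((N' powr\<^sub>o (t - 1) o\<^sub>L Y) o\<^sub>L P powr\<^sub>o (1/2))"
    by (simp add: blinfun_compose_assoc Y_def op_powr_simps P)
  also have "\<dots> = P powr\<^sub>o (1/2) o\<^sub>L (N powr\<^sub>o 1 o\<^sub>L (N powr\<^sub>o (t - 1) o\<^sub>L P powr\<^sub>o (1/2)))"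
  proof -
    have "Q powr\<^sub>o (1/2) o\<^sub>L Y = Q powr\<^sub>o 1 o\<^sub>L P powr\<^sub>o (-1/2)"
      by (simp add: Y_def op_powr_compose_left op_powr_simps Q)
    also have "\<dots> = P powr\<^sub>o (1/2) o\<^sub>L N"
      by (simp add: N_def op_powr_simps P Q)
    finally have "Q powr\<^sub>o (1/2) o\<^sub>L (Y o\<^sub>L X) = P powr\<^sub>o (1/2) o\<^sub>L (N o\<^sub>L X)" for X
      by (metis blinfun_compose_assoc)
    then show ?thesis by (simp add: YN [symmetric] blinfun_compose_assoc op_powr_1 pdN)
  qed
  also have "\<dots> = geometric_mean t P Q"
    unfolding geometric_mean_eq N_def [symmetric] by (simp add: op_powr_compose_left pdN)
  finally show ?thesis by simp
qed

lemma geometric_mean_mono_right: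
  fixes P Q Q' :: "'a::complex_hilbert_space \<Rightarrow>\<^sub>L 'a"
  assumes "positive_definite P" and "positive_definite Q" and "positive_definite Q'"
    and "Q \<preceq> Q'" and "0 \<le> t" and "t \<le> 1"
  shows "geometric_mean t P Q \<preceq> geometric_mean t P Q'"
  unfolding geometric_mean_eq
  by (intro loewner_le_conj_op_powr loewner_heinz pd_conj_op_powr assms)

text \<open>
  Monotonicity in the second argument is the Loewner-Heinz inequality; \<open>geometric_mean_commute\<close>
  transfers it to the first.
\<close>

lemma geometric_mean_mono:
  fixes P P' Q Q' :: "'a::complex_hilbert_space \<Rightarrow>\<^sub>L 'a"
  assumes P: "positive_definite P" "positive_definite P'"
    and Q: "positive_definite Q" "positive_definite Q'"
    and "P \<preceq> P'" and "Q \<preceq> Q'" and "0 \<le> t" and "t \<le> 1"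
  shows "geometric_mean t P Q \<preceq> geometric_mean t P' Q'"
proof (rule loewner_le_trans)
  show "geometric_mean t P Q \<preceq> geometric_mean t P Q'"
    by (intro geometric_mean_mono_right assms)
  have "geometric_mean (1 - t) Q' P \<preceq> geometric_mean (1 - t) Q' P'"
    by (intro geometric_mean_mono_right assms) (use assms in auto)
  then show "geometric_mean t P Q' \<preceq> geometric_mean t P' Q'"
    by (simp add: geometric_mean_commute [of _ Q' t] P Q)
qed

section \<open>The Ando-Hiai inequality\<close>

text \<open>
  Write \<open>p = 2 - e\<close> and \<open>C = A powr\<^sub>o (-1/2) o\<^sub>L B o\<^sub>L A powr\<^sub>o (-1/2)\<close>.  The hypothesis says \<open>A \<preceq> C powr\<^sub>o (- t)\<close>.
  Both powers are conjugates by \<open>A powr\<^sub>o (1/2)\<close>: that of \<open>A\<close> comes from \<open>A powr\<^sub>o (1 - e)\<close>, and that of \<open>B\<close>,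
  read as \<open>B o\<^sub>L B powr\<^sub>o (- e) o\<^sub>L B\<close>, comes from \<open>C o\<^sub>L X o\<^sub>L C\<close>, where \<open>X\<close> is the weighted mean of \<open>A\<close> and the
  inverse of \<open>C\<close> with weight \<open>e\<close>.  Two uses of Loewner-Heinz bound both by powers of \<open>C\<close>, whose mean is
  \<open>C powr\<^sub>o t\<close>; conjugating back gives the mean of \<open>A\<close> and \<open>B\<close>.
\<close>

lemma ando_hiai_le_two:
  fixes A B :: "'a::complex_hilbert_space \<Rightarrow>\<^sub>L 'a"
  assumes A: "positive_definite A" and B: "positive_definite B"
    and t: "0 \<le> t" "t \<le> 1" and le: "geometric_mean t A B \<preceq> id_blinfun"
    and p: "1 \<le> p" "p \<le> 2"
  shows "geometric_mean t (A powr\<^sub>o p) (B powr\<^sub>o p) \<preceq> id_blinfun"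
proof -
  define e where "e = 2 - p"
  have e: "0 \<le> 1 - e" "1 - e \<le> 1" using p by (simp_all add: e_def)
  define C where "C = A powr\<^sub>o (-1/2) o\<^sub>L (B o\<^sub>L A powr\<^sub>o (-1/2))"
  define W where "W = C powr\<^sub>o (1/2) o\<^sub>L (A o\<^sub>L C powr\<^sub>o (1/2))"
  define X where "X = A powr\<^sub>o (1/2) o\<^sub>L (B powr\<^sub>o (- e) o\<^sub>L A powr\<^sub>o (1/2))"
  have C: "positive_definite C" unfolding C_def by (intro pd_conj_op_powr A B)
  have W: "positive_definite W" unfolding W_def by (intro pd_conj_op_powr A C)
  have X: "positive_definite X" unfolding X_def by (intro pd_conj_op_powr pd_op_powr A B)
  note pds = A B C W X
  have B_eq: "B = A powr\<^sub>o (1/2) o\<^sub>L (C o\<^sub>L A powr\<^sub>o (1/2))"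
    by (simp add: C_def op_powr_simps A)
  have gm: "geometric_mean t A B = A powr\<^sub>o (1/2) o\<^sub>L (C powr\<^sub>o t o\<^sub>L A powr\<^sub>o (1/2))"
    by (simp add: geometric_mean_eq C_def)
  have AC: "A \<preceq> C powr\<^sub>o (- t)"
  proof -
    have "geometric_mean t A B powr\<^sub>o (- 1) = A powr\<^sub>o (-1/2) o\<^sub>L (C powr\<^sub>o (- t) o\<^sub>L A powr\<^sub>o (-1/2))"
      by (rule op_powr_minus_1_eqI [OF pd_geometric_mean [OF A B]])
        (simp add: gm op_powr_simps A C)
    with id_le_inverse [OF pd_geometric_mean [OF A B] le]
    have "id_blinfun \<preceq> A powr\<^sub>o (-1/2) o\<^sub>L (C powr\<^sub>o (- t) o\<^sub>L A powr\<^sub>o (-1/2))" by simp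
    from loewner_le_conj_op_powr [OF this A, of "1/2"] show ?thesis
      by (simp add: op_powr_simps A)
  qed
  have A_le: "A powr\<^sub>o (1 - e) \<preceq> C powr\<^sub>o (- t * (1 - e))"
    using loewner_heinz [OF A pd_op_powr [OF C] AC e] by (simp add: op_powr_powr C)
  \<comment> \<open>Rewriting the mean of \<open>A\<close> and the inverse of \<open>C\<close> with the roles exchanged puts \<open>A\<close> inside a power with
    exponent \<open>1 - e\<close>, to which Loewner-Heinz applies.\<close>
  have X_eq: "X = C powr\<^sub>o (-1/2) o\<^sub>L (W powr\<^sub>o (1 - e) o\<^sub>L C powr\<^sub>o (-1/2))"
  proof -
    define Y where "Y = A powr\<^sub>o (1/2) o\<^sub>L C powr\<^sub>o (1/2)"
    define Y' where "Y' = C powr\<^sub>o (1/2) o\<^sub>L A powr\<^sub>o (1/2)"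
    have Y'Y: "Y' o\<^sub>L Y = W" by (simp add: Y_def Y'_def W_def op_powr_simps A)
    have "C powr\<^sub>o (1/2) o\<^sub>L (C powr\<^sub>o (1/2) o\<^sub>L Z) = C o\<^sub>L Z" for Z :: "'a \<Rightarrow>\<^sub>L 'a"
      by (simp add: op_powr_simps C)
    then have YY': "Y o\<^sub>L Y' = B" unfolding B_eq by (simp add: Y_def Y'_def blinfun_compose_assoc)
    have "Y o\<^sub>L W = B o\<^sub>L Y" by (simp only: Y'Y [symmetric] YY' [symmetric] blinfun_compose_assoc)
    then have YW: "Y o\<^sub>L W powr\<^sub>o (- e) = B powr\<^sub>o (- e) o\<^sub>L Y" by (rule op_powr_intertwine [OF B W])
    have "X = C powr\<^sub>o (-1/2) o\<^sub>L (Y' o\<^sub>L ((B powr\<^sub>o (- e) o\<^sub>L Y) o\<^sub>L C powr\<^sub>o (-1/2)))"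
      by (simp add: X_def Y_def Y'_def op_powr_simps C)
    also have "\<dots> = C powr\<^sub>o (-1/2) o\<^sub>L ((Y' o\<^sub>L Y) o\<^sub>L (W powr\<^sub>o (- e) o\<^sub>L C powr\<^sub>o (-1/2)))"
      by (simp only: YW [symmetric] blinfun_compose_assoc)
    also have "\<dots> = C powr\<^sub>o (-1/2) o\<^sub>L (W powr\<^sub>o 1 o\<^sub>L (W powr\<^sub>o (- e) o\<^sub>L C powr\<^sub>o (-1/2)))"
      by (simp only: Y'Y op_powr_1 [OF W])
    finally show ?thesis by (simp add: op_powr_compose_left W)
  qed
  have "W \<preceq> C powr\<^sub>o (1 - t)"
    using loewner_le_conj_op_powr [OF AC C, of "1/2"]
    by (simp add: W_def op_powr_simps C)
  from loewner_heinz [OF W pd_op_powr [OF C] this e]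
  have "W powr\<^sub>o (1 - e) \<preceq> C powr\<^sub>o ((1 - t) * (1 - e))" by (simp add: op_powr_powr C)
  from loewner_le_conj_op_powr [OF this C, of "1/2"]
  have "C powr\<^sub>o (1/2) o\<^sub>L (W powr\<^sub>o (1 - e) o\<^sub>L C powr\<^sub>o (1/2))
      \<preceq> C powr\<^sub>o ((1 - t) * (1 - e) + 1)"
    by (simp add: op_powr_simps C add.commute)
  moreover have "C powr\<^sub>o (1/2) o\<^sub>L (W powr\<^sub>o (1 - e) o\<^sub>L C powr\<^sub>o (1/2))
      = C powr\<^sub>o 1 o\<^sub>L (X o\<^sub>L C powr\<^sub>o 1)"
    unfolding X_eq by (simp add: op_powr_compose op_powr_compose_left blinfun_compose_assoc C)
  ultimately have CXC_le: "C powr\<^sub>o 1 o\<^sub>L (X o\<^sub>L C powr\<^sub>o 1) \<preceq> C powr\<^sub>o ((1 - t) * (1 - e) + 1)"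
    by simp
  have Ap: "A powr\<^sub>o p = A powr\<^sub>o (1/2) o\<^sub>L (A powr\<^sub>o (1 - e) o\<^sub>L A powr\<^sub>o (1/2))"
    by (simp add: op_powr_compose A e_def)
  have Bp: "B powr\<^sub>o p = A powr\<^sub>o (1/2) o\<^sub>L ((C powr\<^sub>o 1 o\<^sub>L (X o\<^sub>L C powr\<^sub>o 1)) o\<^sub>L A powr\<^sub>o (1/2))"
  proof -
    have "B powr\<^sub>o p = B powr\<^sub>o 1 o\<^sub>L (B powr\<^sub>o (- e) o\<^sub>L B powr\<^sub>o 1)"
      by (simp only: op_powr_compose [OF B]) (simp add: e_def)
    also have "\<dots> = (A powr\<^sub>o (1/2) o\<^sub>L (C o\<^sub>L A powr\<^sub>o (1/2))) o\<^sub>L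
        (B powr\<^sub>o (- e) o\<^sub>L (A powr\<^sub>o (1/2) o\<^sub>L (C o\<^sub>L A powr\<^sub>o (1/2))))"
      by (simp only: op_powr_1 [OF B] B_eq [symmetric])
    finally show ?thesis by (simp add: X_def blinfun_compose_assoc op_powr_1 C)
  qed
  have "geometric_mean t (A powr\<^sub>o p) (B powr\<^sub>o p) = A powr\<^sub>o (1/2) o\<^sub>L
      (geometric_mean t (A powr\<^sub>o (1 - e)) (C powr\<^sub>o 1 o\<^sub>L (X o\<^sub>L C powr\<^sub>o 1)) o\<^sub>L A powr\<^sub>o (1/2))"
    unfolding Ap Bp by (intro geometric_mean_conj pd_conj_op_powr pd_op_powr pds)
  also have "\<dots> \<preceq> A powr\<^sub>o (1/2) o\<^sub>L (geometric_mean t (C powr\<^sub>o (- t * (1 - e)))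
      (C powr\<^sub>o ((1 - t) * (1 - e) + 1)) o\<^sub>L A powr\<^sub>o (1/2))"
    by (intro loewner_le_conj_op_powr geometric_mean_mono pd_conj_op_powr pd_op_powr pds A_le CXC_le t)
  also have "\<dots> = geometric_mean t A B"
  proof -
    have "(1 - t) * (- t * (1 - e)) + t * ((1 - t) * (1 - e) + 1) = t"
      by (simp add: algebra_simps)
    then show ?thesis by (simp only: gm geometric_mean_op_powr [OF C])
  qed
  finally show ?thesis using le by (rule loewner_le_trans)
qed

text \<open>
  An exponent \<open>p\<close> above \<open>2\<close> is reached by squaring \<open>A powr\<^sub>o (p/2)\<close> and \<open>B powr\<^sub>o (p/2)\<close>, and finitely many
  halvings bring \<open>p\<close> down to the interval from \<open>1\<close> to \<open>2\<close>.
\<close>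

theorem ando_hiai:
  fixes A B :: "'a::complex_hilbert_space \<Rightarrow>\<^sub>L 'a"
  assumes A: "positive_definite A" and B: "positive_definite B"
    and t: "0 \<le> t" "t \<le> 1" and le: "geometric_mean t A B \<preceq> id_blinfun" and "1 \<le> p"
  shows "geometric_mean t (A powr\<^sub>o p) (B powr\<^sub>o p) \<preceq> id_blinfun"
proof -
  have "geometric_mean t (A powr\<^sub>o p) (B powr\<^sub>o p) \<preceq> id_blinfun"
    if "1 \<le> p" "p \<le> 2 ^ n" for n and p :: real
    using that
  proof (induction n arbitrary: p)
    case 0
    then have "p = 1" by simp
    then show ?case using le by (simp add: op_powr_1 A B)
  next
    case (Suc n)
    show ?case
    proof (cases "p \<le> 2")
      case True
      then show ?thesis by (intro ando_hiai_le_two A B t le Suc.prems)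
    next
      case False
      then have "geometric_mean t (A powr\<^sub>o (p/2)) (B powr\<^sub>o (p/2)) \<preceq> id_blinfun"
        using Suc.prems by (intro Suc.IH) auto
      from ando_hiai_le_two [OF _ _ t this, of 2] show ?thesis
        by (simp add: pd_op_powr op_powr_powr A B)
    qed
  qed
  moreover obtain n where "p \<le> 2 ^ n"
    using real_arch_pow [of 2 p] by (auto intro: less_imp_le)
  ultimately show ?thesis using \<open>1 \<le> p\<close> by blast
qed

section \<open>The spectral geometric mean\<close>

text \<open>
  The hypothesis makes \<open>C powr\<^sub>o (1/2) o\<^sub>L g o\<^sub>L C powr\<^sub>o (-1/2)\<close>, which is similar to \<open>g\<close>, a contraction.
\<close>

lemma le_id_of_conj_le:
  fixes C g :: "'a::complex_hilbert_space \<Rightarrow>\<^sub>L 'a"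
  assumes C: "positive_definite C" and g: "positive_definite g" and le: "g o\<^sub>L (C o\<^sub>L g) \<preceq> C"
  shows "g \<preceq> id_blinfun"
proof (rule self_adjoint_similar_to_contraction_le_id)
  let ?Y = "(C powr\<^sub>o (1/2) o\<^sub>L g) o\<^sub>L C powr\<^sub>o (-1/2)"
  have adj: "adjoint_pair g g"
    using pd_self_adjoint [OF g] by (simp add: self_adjoint_iff_adjoint_pair)
  show "clinear_op ?Y"
    by (intro clinear_op_compose self_adjoint_clinear pd_self_adjoint pd_op_powr C g)
  show "C powr\<^sub>o (1/2) o\<^sub>L g = ?Y o\<^sub>L C powr\<^sub>o (1/2)"
    by (simp add: op_powr_simps C)
  show "norm (?Y v) \<le> norm v" for v
  proof (rule contraction_of_loewner_le [OF _ _ C])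
    show "adjoint_pair (C powr\<^sub>o (1/2) o\<^sub>L g) (g o\<^sub>L C powr\<^sub>o (1/2))"
      by (intro adjoint_pair_compose adjoint_pair_op_powr adj C)
    show "(g o\<^sub>L C powr\<^sub>o (1/2)) o\<^sub>L (C powr\<^sub>o (1/2) o\<^sub>L g) \<preceq> C"
      using le by (simp add: op_powr_simps C)
  qed
qed (intro pd_self_adjoint invertible_op_powr C g)+

text \<open>
  The positive operator \<open>E = D powr\<^sub>o (1/2) o\<^sub>L g o\<^sub>L D powr\<^sub>o (1/2)\<close> has the same square as \<open>D\<close>, hence equals \<open>D\<close>
  by uniqueness of positive square roots.
\<close>

lemma eq_id_of_conj_eq:
  fixes D g :: "'a::complex_hilbert_space \<Rightarrow>\<^sub>L 'a"
  assumes D: "positive_definite D" and g: "positive_definite g" and eq: "g o\<^sub>L (D o\<^sub>L g) = D"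
  shows "g = id_blinfun"
proof -
  define E where "E = D powr\<^sub>o (1/2) o\<^sub>L (g o\<^sub>L D powr\<^sub>o (1/2))"
  have E: "positive_definite E" unfolding E_def by (intro pd_conj_op_powr D g)
  have "E powr\<^sub>o 2 = E powr\<^sub>o 1 o\<^sub>L E powr\<^sub>o 1" by (simp only: op_powr_compose [OF E]) simp
  also have "\<dots> = D powr\<^sub>o (1/2) o\<^sub>L ((g o\<^sub>L (D o\<^sub>L g)) o\<^sub>L D powr\<^sub>o (1/2))"
    unfolding op_powr_1 [OF E] by (simp add: E_def op_powr_simps D)
  also have "\<dots> = D powr\<^sub>o (1/2) o\<^sub>L (D powr\<^sub>o 1 o\<^sub>L D powr\<^sub>o (1/2))"
    by (simp only: eq op_powr_1 [OF D])
  also have "\<dots> = D powr\<^sub>o 2" by (simp only: op_powr_compose [OF D]) simp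
  finally have "(E powr\<^sub>o 2) powr\<^sub>o (1/2) = (D powr\<^sub>o 2) powr\<^sub>o (1/2)" by simp
  then have "E = D" by (simp add: op_powr_powr op_powr_1 D E)
  have "g = D powr\<^sub>o (-1/2) o\<^sub>L (E o\<^sub>L D powr\<^sub>o (-1/2))"
    by (simp add: E_def op_powr_simps D)
  also have "\<dots> = D powr\<^sub>o (-1/2) o\<^sub>L (D powr\<^sub>o 1 o\<^sub>L D powr\<^sub>o (-1/2))"
    by (simp only: \<open>E = D\<close> op_powr_1 [OF D])
  also have "\<dots> = id_blinfun"
    by (simp only: op_powr_compose [OF D]) (simp add: op_powr_0 D)
  finally show ?thesis .
qed

theorem proposition3p2:
  fixes A B :: "'a::complex_hilbert_space \<Rightarrow>\<^sub>L 'a" and t :: real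
  assumes "positive_definite A" and "positive_definite B"
    and "0 \<le> t" and "t \<le> 1"
  shows "(spectral_mean t (op_inverse A) B \<preceq> A powr\<^sub>o (2 * (t - 1))
        \<longrightarrow> (\<forall>p::real. 1 \<le> p \<longrightarrow> geometric_mean t (A powr\<^sub>o p) (B powr\<^sub>o p) \<preceq> id_blinfun))
    \<and> (0 < t \<longrightarrow>
        (spectral_mean t A B = A powr\<^sub>o (2 - 2 * t) \<longleftrightarrow> B = A powr\<^sub>o (1 / t - 1)))"
proof (intro conjI impI allI)
  note A = assms(1) and B = assms(2)
  fix p :: real
  assume le: "spectral_mean t (op_inverse A) B \<preceq> A powr\<^sub>o (2 * (t - 1))" and "1 \<le> p"
  define G where "G = geometric_mean t A B"
  have G: "positive_definite G" unfolding G_def by (rule pd_geometric_mean [OF A B])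
  have "op_inverse (op_inverse A) = A" "op_inverse A powr\<^sub>o (2 - 2 * t) = A powr\<^sub>o (2 * (t - 1))"
    by (simp_all add: op_inverse_pd pd_op_powr op_powr_powr op_powr_1 A algebra_simps)
  with le have "G powr\<^sub>o (1/2) o\<^sub>L (A powr\<^sub>o (2 * (t - 1)) o\<^sub>L G powr\<^sub>o (1/2)) \<preceq> A powr\<^sub>o (2 * (t - 1))"
    by (simp add: spectral_mean_def G_def blinfun_compose_assoc)
  then have g_le: "G powr\<^sub>o (1/2) \<preceq> id_blinfun"
    by (intro le_id_of_conj_le [OF pd_op_powr [OF A] pd_op_powr [OF G]])
  \<comment> \<open>Conjugating \<open>G powr\<^sub>o (1/2) \<preceq> id_blinfun\<close> by the fourth root of \<open>G\<close>.\<close>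
  have "G \<preceq> G powr\<^sub>o (1/2)"
    using loewner_le_conj_op_powr [OF g_le G, of "1/4"] by (simp add: op_powr_simps G)
  then have "G \<preceq> id_blinfun" using g_le by (rule loewner_le_trans)
  then show "geometric_mean t (A powr\<^sub>o p) (B powr\<^sub>o p) \<preceq> id_blinfun"
    unfolding G_def using \<open>1 \<le> p\<close> by (intro ando_hiai assms)
next
  note A = assms(1) and B = assms(2)
  assume t: "0 < t"
  define G where "G = geometric_mean t (A powr\<^sub>o (- 1)) B"
  have G: "positive_definite G" unfolding G_def by (intro pd_geometric_mean pd_op_powr A B)
  have mean: "spectral_mean t A B
      = G powr\<^sub>o (1/2) o\<^sub>L (A powr\<^sub>o (2 - 2 * t) o\<^sub>L G powr\<^sub>o (1/2))"
    by (simp add: spectral_mean_def G_def op_inverse_pd A blinfun_compose_assoc)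
  show "spectral_mean t A B = A powr\<^sub>o (2 - 2 * t) \<longleftrightarrow> B = A powr\<^sub>o (1 / t - 1)"
  proof
    assume "spectral_mean t A B = A powr\<^sub>o (2 - 2 * t)"
    then have g: "G powr\<^sub>o (1/2) = id_blinfun"
      unfolding mean by (rule eq_id_of_conj_eq [OF pd_op_powr [OF A] pd_op_powr [OF G]])
    have "G = G powr\<^sub>o (1/2) o\<^sub>L G powr\<^sub>o (1/2)" by (simp add: op_powr_simps G)
    with g have G_id: "G = id_blinfun" by simp
    define N where "N = A powr\<^sub>o (1/2) o\<^sub>L (B o\<^sub>L A powr\<^sub>o (1/2))"
    have N: "positive_definite N" unfolding N_def by (intro pd_conj_op_powr A B)
    have "G = A powr\<^sub>o (-1/2) o\<^sub>L (N powr\<^sub>o t o\<^sub>L A powr\<^sub>o (-1/2))"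
      by (simp add: G_def geometric_mean_eq N_def op_powr_powr A)
    then have "A powr\<^sub>o (1/2) o\<^sub>L (G o\<^sub>L A powr\<^sub>o (1/2)) = N powr\<^sub>o t"
      by (simp add: op_powr_simps A)
    then have "N powr\<^sub>o t = A" by (simp add: G_id op_powr_simps A)
    then have "A powr\<^sub>o (1/t) = N"
      using t by (auto simp: op_powr_powr op_powr_1 N)
    then have "A powr\<^sub>o (-1/2) o\<^sub>L (N o\<^sub>L A powr\<^sub>o (-1/2)) = A powr\<^sub>o (1/t - 1)"
      by (auto simp: op_powr_simps A)
    then show "B = A powr\<^sub>o (1/t - 1)" by (simp add: N_def op_powr_simps A)
  next
    assume "B = A powr\<^sub>o (1/t - 1)"
    then have "G = id_blinfun"
      using t by (simp add: G_def geometric_mean_op_powr A op_powr_0 field_simps)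
    moreover have "id_blinfun powr\<^sub>o (1/2) = (id_blinfun :: 'a \<Rightarrow>\<^sub>L 'a)"
      using op_powr_powr [OF A, of 0 "1/2"] by (simp add: op_powr_0 A)
    ultimately show "spectral_mean t A B = A powr\<^sub>o (2 - 2 * t)" by (simp add: mean)
  qed
qed

end
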